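(* Let $E$ be a Banach lattice, let $x\in E$, and let $\mathscr{F}_x$ be the functional on $E'$ given by $\mathscr{F}_x(x')=x'(x)$. The following conditions are equivalent: (1) $\mathscr{F}_x\in(E')^\sim_{uaw^*}$; (2) $\mathscr{F}_x(x'_n)\to0$ for any norm bounded $uaw^*$-null sequence $(x'_n)$ in $E'$; (3) $\mathscr{F}_x\in(E')^\sim_{uo}$; (4) $\mathscr{F}_x(x'_n)\to0$ for any norm bounded $uo$-null sequence $(x'_n)$ in $E'$; (5) $\mathscr{F}_x\in(E')^\sim_{uaw}$; (6) $\mathscr{F}_x(x'_n)\to0$ for any norm bounded $uaw$-null sequence $(x'_n)$ in $E'$; (7) $\mathscr{F}_x\in(E')^\sim_{d}$; (8) $\mathscr{F}_x(x'_n)\to0$ for any norm bounded disjoint sequence $(x'_n)$ in $E'$; (9) every disjoint sequence in $[0,|x|]$ is norm convergent to zero. In addition, if $E'$ has order continuous norm, these conditions are equivalent to each of: (10) $\mathscr{F}_x\in(E')^\sim_{un}$; (11) $\mathscr{F}_x(x'_n)\to0$ for any norm bounded $un$-null sequence $(x'_n)$ in $E'$.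
   Context: Order convergence: a net $(x_\alpha)$ in a Riesz space is order convergent to $x$ if there is a net $(y_\beta)$, possibly over a different index set, with $y_\beta\downarrow 0$ such that for each $\beta$ there is $\alpha_0$ with $|x_\alpha-x|\le y_\beta$ for all $\alpha\ge\alpha_0$. A net $(x_\alpha)$ is disjoint if $|x_\alpha|\wedge|x_\beta|=0$ whenever $\alpha\neq\beta$. A net $(x_\alpha)$ in a Banach lattice $X$ is $uo$-null (resp. $un$-null, $uaw$-null) if for every $u\in X_+$ the net $(|x_\alpha|\wedge u)$ converges to $0$ in order (resp. in norm, weakly). A net $(x'_\alpha)$ in the dual $E'$ is $uaw^*$-null if $|x'_\alpha|\wedge u'\to0$ in the weak* topology $\sigma(E',E)$ for every $u'\in E'_+$. Duals: for a Banach lattice $X$, $X^\sim_{uo}$ is the set of linear functionals $f$ on $X$ with $f(x_\alpha)\to0$ for every norm bounded $uo$-null net in $X$; $X^\sim_d$ (resp. $X^\sim_{un}$, $X^\sim_{uaw}$) is the set of norm bounded linear functionals $f$ on $X$ with $f(x_\alpha)\to0$ for every norm bounded disjoint (resp. $un$-null, $uaw$-null) net $(x_\alpha)$ in $X$. These are applied with $X=E'$. $(E')^\sim_{uaw^*}$ is the set of norm bounded linear functionals $f$ on $E'$ with $f(x'_\alpha)\to0$ for every norm bounded $uaw^*$-null net $(x'_\alpha)$ in $E'$. A Banach lattice has order continuous norm if $\|x_\alpha\|\to0$ for every net $x_\alpha\downarrow0$.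
   Formalization: In (7), disjoint nets are taken over directed sets without a greatest element; read literally, one-point nets are vacuously disjoint, so only the zero functional would lie in the disjoint dual and the equivalence would fail, e.g. for E the real line and x = 1. *)

theory Defs
  imports "HOL-Analysis.Analysis" "HOL-Library.Lattice_Algebras"
begin

section \<open>Banach lattices\<close>

class banach_lattice = banach + ordered_real_vector + lattice_ab_group_add_abs +
  assumes norm_lattice: "\<bar>x\<bar> \<le> \<bar>y\<bar> \<Longrightarrow> norm x \<le> norm y"

lemma banach_lattice_norm_mono:
  fixes x y :: "'a::banach_lattice"
  assumes "0 \<le> x" "x \<le> y"
  shows "norm x \<le> norm y"
  using assms by (intro norm_lattice) simp

lemma banach_lattice_norm_abs:
  fixes x :: "'a::banach_lattice"
  shows "norm \<bar>x\<bar> = norm x"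
  by (intro antisym norm_lattice) simp_all


section \<open>The norm dual of a Banach lattice\<close>

text \<open>
  The lattice structure cannot be put on the general type of bounded operators, so the norm dual
  gets its own type, with the operator norm and the order
  \<open>f \<le> g \<longleftrightarrow> (\<forall>x\<ge>0. f x \<le> g x)\<close>.
  The lattice operations are given by the Riesz--Kantorovich formula.
\<close>

typedef (overloaded) 'a dual = "UNIV :: ('a::real_normed_vector \<Rightarrow>\<^sub>L real) set"
  morphisms blinfun_of_dual dual_of_blinfun ..

setup_lifting type_definition_dual

lift_definition dual_apply :: "'a::real_normed_vector dual \<Rightarrow> 'a \<Rightarrow> real"
  is "\<lambda>f x. blinfun_apply f x" .

lemma dual_eqI: "(\<And>x. dual_apply f x = dual_apply g x) \<Longrightarrow> f = g"
  by transfer (rule blinfun_eqI)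

instantiation dual :: (real_normed_vector) real_normed_vector
begin

lift_definition zero_dual :: "'a dual" is 0 .
lift_definition plus_dual :: "'a dual \<Rightarrow> 'a dual \<Rightarrow> 'a dual" is "(+)" .
lift_definition minus_dual :: "'a dual \<Rightarrow> 'a dual \<Rightarrow> 'a dual" is "(-)" .
lift_definition uminus_dual :: "'a dual \<Rightarrow> 'a dual" is uminus .
lift_definition scaleR_dual :: "real \<Rightarrow> 'a dual \<Rightarrow> 'a dual" is scaleR .
lift_definition norm_dual :: "'a dual \<Rightarrow> real" is norm .

definition dist_dual :: "'a dual \<Rightarrow> 'a dual \<Rightarrow> real"
  where "dist_dual a b = norm (a - b)"

definition sgn_dual :: "'a dual \<Rightarrow> 'a dual"
  where "sgn_dual x = scaleR (inverse (norm x)) x"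

definition uniformity_dual :: "('a dual \<times> 'a dual) filter"
  where "uniformity_dual = (INF e\<in>{0 <..}. principal {(x, y). dist x y < e})"

definition open_dual :: "'a dual set \<Rightarrow> bool"
  where "open_dual S = (\<forall>x\<in>S. \<forall>\<^sub>F (x', y) in uniformity. x' = x \<longrightarrow> y \<in> S)"

instance
  apply standard
  unfolding dist_dual_def open_dual_def sgn_dual_def uniformity_dual_def
  apply (rule refl | (transfer, force simp: algebra_simps norm_triangle_ineq))+
  done

end

lemma dual_apply_simps [simp]:
  "dual_apply 0 x = 0"
  "dual_apply (f + g) x = dual_apply f x + dual_apply g x"
  "dual_apply (f - g) x = dual_apply f x - dual_apply g x"
  "dual_apply (- f) x = - dual_apply f x"
  "dual_apply (c *\<^sub>R f) x = c * dual_apply f x"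
  by (transfer, simp add: blinfun.bilinear_simps)+

lemma bounded_linear_dual_apply: "bounded_linear (dual_apply f)"
  by transfer (rule bounded_linear_blinfun_apply, rule bounded_linear_ident)

lemma dual_apply_right_simps [simp]:
  "dual_apply f 0 = 0"
  "dual_apply f (x + y) = dual_apply f x + dual_apply f y"
  "dual_apply f (x - y) = dual_apply f x - dual_apply f y"
  "dual_apply f (- x) = - dual_apply f x"
  "dual_apply f (c *\<^sub>R x) = c * dual_apply f x"
  by (transfer, simp add: blinfun.bilinear_simps)+

lemma abs_dual_apply_le: "\<bar>dual_apply f x\<bar> \<le> norm f * norm x"
  by transfer (metis norm_blinfun real_norm_def)

lemma norm_dual_bound:
  "0 \<le> b \<Longrightarrow> (\<And>x. \<bar>dual_apply f x\<bar> \<le> b * norm x) \<Longrightarrow> norm f \<le> b"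
  by transfer (simp add: norm_blinfun_bound)

lemma dual_exI:
  assumes "bounded_linear h"
  shows "\<exists>f. dual_apply f = h"
  using assms by (intro exI[of _ "dual_of_blinfun (Blinfun h)"])
    (simp add: dual_apply.rep_eq dual_of_blinfun_inverse bounded_linear_Blinfun_apply)

instance dual :: (real_normed_vector) banach
proof
  fix X :: "nat \<Rightarrow> 'a dual"
  assume "Cauchy X"
  have d: "dist (blinfun_of_dual f) (blinfun_of_dual g) = dist f g" for f g :: "'a dual"
    by (simp add: dist_norm norm_dual.rep_eq minus_dual.rep_eq)
  have "Cauchy (\<lambda>n. blinfun_of_dual (X n))"
    using \<open>Cauchy X\<close> by (simp add: Cauchy_def d)
  then obtain l where "(\<lambda>n. blinfun_of_dual (X n)) \<longlonglongrightarrow> l"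
    by (auto simp: Cauchy_convergent_iff convergent_def)
  then have "X \<longlonglongrightarrow> dual_of_blinfun l"
    by (simp add: tendsto_iff d[symmetric] dual_of_blinfun_inverse)
  then show "convergent X" by (auto simp: convergent_def)
qed

definition rk_pos :: "('a::banach_lattice \<Rightarrow> real) \<Rightarrow> 'a \<Rightarrow> real"
  where "rk_pos h x = (SUP y\<in>{0..x}. h y)"

definition dual_pprt :: "'a::banach_lattice dual \<Rightarrow> 'a dual"
  where "dual_pprt f = dual_of_blinfun (Blinfun
    (\<lambda>x. rk_pos (dual_apply f) (pprt x) - rk_pos (dual_apply f) (- nprt x)))"

context
  fixes f :: "'a::banach_lattice dual"
begin

lemma rk_bdd: "bdd_above (dual_apply f ` {0..x})"
proof (rule bdd_aboveI2)
  fix y assume "y \<in> {0..x}"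
  then have "norm y \<le> norm x" by (simp add: banach_lattice_norm_mono)
  then have "norm f * norm y \<le> norm f * norm x" by (simp add: mult_left_mono)
  then show "dual_apply f y \<le> norm f * norm x" using abs_dual_apply_le[of f y] by linarith
qed

lemma rk_upper: "0 \<le> y \<Longrightarrow> y \<le> x \<Longrightarrow> dual_apply f y \<le> rk_pos (dual_apply f) x"
  unfolding rk_pos_def by (rule cSUP_upper[OF _ rk_bdd]) simp

lemma rk_least:
  "0 \<le> x \<Longrightarrow> (\<And>y. 0 \<le> y \<Longrightarrow> y \<le> x \<Longrightarrow> dual_apply f y \<le> b) \<Longrightarrow> rk_pos (dual_apply f) x \<le> b"
  unfolding rk_pos_def by (rule cSUP_least) auto

lemma rk_nonneg: "0 \<le> x \<Longrightarrow> 0 \<le> rk_pos (dual_apply f) x"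
  using rk_upper[of 0 x] by simp

lemma rk_le_norm: "0 \<le> x \<Longrightarrow> rk_pos (dual_apply f) x \<le> norm f * norm x"
proof (rule rk_least)
  fix y assume "0 \<le> y" "y \<le> x"
  then have "norm y \<le> norm x" by (simp add: banach_lattice_norm_mono)
  then have "norm f * norm y \<le> norm f * norm x" by (simp add: mult_left_mono)
  then show "dual_apply f y \<le> norm f * norm x" using abs_dual_apply_le[of f y] by linarith
qed

lemma rk_add:
  assumes "0 \<le> x" "0 \<le> y"
  shows "rk_pos (dual_apply f) (x + y) = rk_pos (dual_apply f) x + rk_pos (dual_apply f) y"
proof (rule antisym)
  show "rk_pos (dual_apply f) (x + y) \<le> rk_pos (dual_apply f) x + rk_pos (dual_apply f) y"
  proof (rule rk_least)
    fix z assume z: "0 \<le> z" "z \<le> x + y"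
    have 1: "dual_apply f (inf z x) \<le> rk_pos (dual_apply f) x"
      using z assms by (intro rk_upper) auto
    have "z - inf z x = sup 0 (z - x)"
      by (simp add: diff_inf_eq_sup add_sup_distrib_left)
    also have "\<dots> \<le> y" using z assms by (simp add: algebra_simps)
    finally have le: "z - inf z x \<le> y" .
    have "0 \<le> z - inf z x" by (simp only: diff_ge_0_iff_ge inf_le1)
    from rk_upper[OF this le] have 2: "dual_apply f (z - inf z x) \<le> rk_pos (dual_apply f) y" .
    have "dual_apply f z = dual_apply f (z - inf z x) + dual_apply f (inf z x)"
      by (simp only: dual_apply_right_simps(2)[symmetric] diff_add_cancel)
    with 1 2 show "dual_apply f z \<le> rk_pos (dual_apply f) x + rk_pos (dual_apply f) y"
      by linarith
  qed (use assms in simp)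
next
  have "rk_pos (dual_apply f) x \<le> rk_pos (dual_apply f) (x + y) - rk_pos (dual_apply f) y"
  proof (rule rk_least[OF assms(1)])
    fix u assume u: "0 \<le> u" "u \<le> x"
    have "rk_pos (dual_apply f) y \<le> rk_pos (dual_apply f) (x + y) - dual_apply f u"
    proof (rule rk_least[OF assms(2)])
      fix v assume v: "0 \<le> v" "v \<le> y"
      have "dual_apply f (u + v) \<le> rk_pos (dual_apply f) (x + y)"
        using u v by (intro rk_upper) (auto intro: add_mono)
      then show "dual_apply f v \<le> rk_pos (dual_apply f) (x + y) - dual_apply f u" by simp
    qed
    then show "dual_apply f u \<le> rk_pos (dual_apply f) (x + y) - rk_pos (dual_apply f) y" by simp
  qed
  then show "rk_pos (dual_apply f) x + rk_pos (dual_apply f) y \<le> rk_pos (dual_apply f) (x + y)"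
    by simp
qed

lemma rk_zero: "rk_pos (dual_apply f) 0 = 0"
  using rk_add[of 0 0] by simp

lemma rk_scale_le:
  assumes "0 < c" "0 \<le> x"
  shows "rk_pos (dual_apply f) (c *\<^sub>R x) \<le> c * rk_pos (dual_apply f) x"
proof (rule rk_least)
  show "0 \<le> c *\<^sub>R x" using assms by (simp add: scaleR_nonneg_nonneg)
  fix y assume y: "0 \<le> y" "y \<le> c *\<^sub>R x"
  have "(1/c) *\<^sub>R y \<le> (1/c) *\<^sub>R (c *\<^sub>R x)" using y assms by (intro scaleR_left_mono) auto
  then have "dual_apply f ((1/c) *\<^sub>R y) \<le> rk_pos (dual_apply f) x"
    using y assms by (intro rk_upper) (auto simp: scaleR_nonneg_nonneg)
  then show "dual_apply f y \<le> c * rk_pos (dual_apply f) x"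
    using assms by (simp add: field_simps)
qed

lemma rk_scale:
  assumes "0 \<le> c" "0 \<le> x"
  shows "rk_pos (dual_apply f) (c *\<^sub>R x) = c * rk_pos (dual_apply f) x"
proof (cases "c = 0")
  case False
  then have c: "0 < c" using assms by simp
  have "rk_pos (dual_apply f) ((1/c) *\<^sub>R (c *\<^sub>R x)) \<le> (1/c) * rk_pos (dual_apply f) (c *\<^sub>R x)"
    using c assms by (intro rk_scale_le) (auto simp: scaleR_nonneg_nonneg)
  then have "c * rk_pos (dual_apply f) x \<le> rk_pos (dual_apply f) (c *\<^sub>R x)"
    using c by (simp add: field_simps)
  with rk_scale_le[OF c assms(2)] show ?thesis by simp
qed (simp add: rk_zero)

lemma rk_diff:
  assumes "0 \<le> u" "0 \<le> v"
  shows "rk_pos (dual_apply f) (pprt (u - v)) - rk_pos (dual_apply f) (- nprt (u - v))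
    = rk_pos (dual_apply f) u - rk_pos (dual_apply f) v"
proof -
  let ?p = "pprt (u - v)" and ?n = "- nprt (u - v)"
  have "u - v = ?p - ?n" using prts[of "u - v"] by simp
  then have "u + ?n = ?p + v" by (metis add.commute add_diff_eq diff_add_cancel diff_diff_eq2)
  then have "rk_pos (dual_apply f) (u + ?n) = rk_pos (dual_apply f) (?p + v)" by (rule arg_cong)
  moreover have "0 \<le> ?p" "0 \<le> ?n" by simp_all
  ultimately have "rk_pos (dual_apply f) u + rk_pos (dual_apply f) ?n
      = rk_pos (dual_apply f) ?p + rk_pos (dual_apply f) v"
    using assms by (simp only: rk_add)
  then show ?thesis by linarith
qed

lemma dual_apply_dual_pprt_aux:
  "dual_apply (dual_pprt f) =
    (\<lambda>x. rk_pos (dual_apply f) (pprt x) - rk_pos (dual_apply f) (- nprt x))" (is "_ = ?P")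
proof -
  have P: "?P (u - v) = rk_pos (dual_apply f) u - rk_pos (dual_apply f) v"
    if "0 \<le> u" "0 \<le> v" for u v using rk_diff[OF that] .
  have "bounded_linear ?P"
  proof (rule bounded_linear_intro[where K = "2 * norm f"])
    fix x y :: 'a and c :: real
    have dec: "z = pprt z - (- nprt z)" for z :: 'a using prts[of z] by simp
    have "x + y = (pprt x + nprt x) + (pprt y + nprt y)" by (simp flip: prts)
    also have "\<dots> = (pprt x + pprt y) - (- nprt x + - nprt y)" by simp
    finally have "?P (x + y) = rk_pos (dual_apply f) (pprt x + pprt y)
        - rk_pos (dual_apply f) (- nprt x + - nprt y)"
      using P[of "pprt x + pprt y" "- nprt x + - nprt y"]
      by (metis add_nonneg_nonneg neg_0_le_iff_le nprt_le_zero zero_le_pprt)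
    also have "\<dots> = (rk_pos (dual_apply f) (pprt x) + rk_pos (dual_apply f) (pprt y))
        - (rk_pos (dual_apply f) (- nprt x) + rk_pos (dual_apply f) (- nprt y))"
      by (simp only: rk_add zero_le_pprt neg_0_le_iff_le nprt_le_zero)
    finally show "?P (x + y) = ?P x + ?P y" by linarith
    show "?P (c *\<^sub>R x) = c *\<^sub>R ?P x"
    proof (cases "0 \<le> c")
      case True
      have "c *\<^sub>R x = c *\<^sub>R pprt x - c *\<^sub>R (- nprt x)"
        by (subst dec[of x]) (simp only: scaleR_right_diff_distrib)
      then have "?P (c *\<^sub>R x) = rk_pos (dual_apply f) (c *\<^sub>R pprt x)
          - rk_pos (dual_apply f) (c *\<^sub>R (- nprt x))"
        using P[of "c *\<^sub>R pprt x" "c *\<^sub>R (- nprt x)"] True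
        by (metis neg_0_le_iff_le nprt_le_zero scaleR_nonneg_nonneg zero_le_pprt)
      also have "\<dots> = c * rk_pos (dual_apply f) (pprt x) - c * rk_pos (dual_apply f) (- nprt x)"
        using True by (simp only: rk_scale zero_le_pprt neg_0_le_iff_le nprt_le_zero)
      finally show ?thesis by (simp add: right_diff_distrib)
    next
      case False
      then have c: "0 \<le> - c" by simp
      have "c *\<^sub>R x = (- c) *\<^sub>R (- nprt x) - (- c) *\<^sub>R pprt x"
        by (subst dec[of x]) (simp add: scaleR_right_distrib)
      then have "?P (c *\<^sub>R x) = rk_pos (dual_apply f) ((- c) *\<^sub>R (- nprt x))
          - rk_pos (dual_apply f) ((- c) *\<^sub>R pprt x)"
        using P[of "(- c) *\<^sub>R (- nprt x)" "(- c) *\<^sub>R pprt x"] c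
        by (metis neg_0_le_iff_le nprt_le_zero scaleR_nonneg_nonneg zero_le_pprt)
      also have "\<dots> = (- c) * rk_pos (dual_apply f) (- nprt x) - (- c) * rk_pos (dual_apply f) (pprt x)"
        using c by (simp only: rk_scale zero_le_pprt neg_0_le_iff_le nprt_le_zero)
      finally show ?thesis by (simp add: algebra_simps)
    qed
    have "norm (pprt x) \<le> norm x" "norm (- nprt x) \<le> norm x"
      by (rule norm_lattice; simp add: abs_prts)+
    then have "norm f * norm (pprt x) \<le> norm f * norm x"
        "norm f * norm (- nprt x) \<le> norm f * norm x"
      by (auto intro: mult_left_mono)
    then show "norm (?P x) \<le> norm x * (2 * norm f)"
      using rk_le_norm[of "pprt x"] rk_le_norm[of "- nprt x"]
        rk_nonneg[of "pprt x"] rk_nonneg[of "- nprt x"]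
      by (simp add: abs_le_iff mult.commute)
  qed
  then show ?thesis
    by (simp add: dual_pprt_def dual_apply.rep_eq dual_of_blinfun_inverse
        bounded_linear_Blinfun_apply)
qed

lemma dual_apply_dual_pprt: "0 \<le> x \<Longrightarrow> dual_apply (dual_pprt f) x = rk_pos (dual_apply f) x"
  by (simp add: dual_apply_dual_pprt_aux rk_zero)

end

instantiation dual :: (banach_lattice) banach_lattice
begin

definition less_eq_dual :: "'a dual \<Rightarrow> 'a dual \<Rightarrow> bool"
  where "less_eq_dual f g \<longleftrightarrow> (\<forall>x\<ge>0. dual_apply f x \<le> dual_apply g x)"

definition less_dual :: "'a dual \<Rightarrow> 'a dual \<Rightarrow> bool"
  where "less_dual f g \<longleftrightarrow> f \<le> g \<and> \<not> g \<le> f"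

definition sup_dual :: "'a dual \<Rightarrow> 'a dual \<Rightarrow> 'a dual"
  where "sup_dual f g = f + dual_pprt (g - f)"

definition inf_dual :: "'a dual \<Rightarrow> 'a dual \<Rightarrow> 'a dual"
  where "inf_dual f g = f - dual_pprt (f - g)"

definition abs_dual :: "'a dual \<Rightarrow> 'a dual"
  where "abs_dual f = sup f (- f)"

instance
proof
  fix f g h :: "'a dual" and a b :: real
  have pprt_ge: "k \<le> dual_pprt k" "0 \<le> dual_pprt k" for k :: "'a dual"
    by (auto simp: less_eq_dual_def dual_apply_dual_pprt rk_upper rk_nonneg)
  have pprt_le: "dual_pprt k \<le> l" if "k \<le> l" "0 \<le> l" for k l :: "'a dual"
    unfolding less_eq_dual_def
  proof (intro allI impI)
    fix x :: 'a assume x: "0 \<le> x"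
    have "rk_pos (dual_apply k) x \<le> dual_apply l x"
    proof (rule rk_least[OF x])
      fix y assume y: "0 \<le> y" "y \<le> x"
      have "0 \<le> x - y" using y by simp
      then have "dual_apply 0 (x - y) \<le> dual_apply l (x - y)"
        using that(2) unfolding less_eq_dual_def by blast
      moreover have "dual_apply k y \<le> dual_apply l y"
        using that(1) y by (simp add: less_eq_dual_def)
      ultimately show "dual_apply k y \<le> dual_apply l x" by simp
    qed
    with x show "dual_apply (dual_pprt k) x \<le> dual_apply l x" by (simp add: dual_apply_dual_pprt)
  qed
  show "f < g \<longleftrightarrow> f \<le> g \<and> \<not> g \<le> f" by (rule less_dual_def)
  show "f \<le> f" by (simp add: less_eq_dual_def)
  show "f \<le> h" if "f \<le> g" "g \<le> h" using that by (force simp: less_eq_dual_def)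
  show "f = g" if "f \<le> g" "g \<le> f"
  proof (rule dual_eqI)
    fix x
    have "dual_apply f y = dual_apply g y" if "0 \<le> y" for y
      using \<open>f \<le> g\<close> \<open>g \<le> f\<close> that by (simp add: less_eq_dual_def antisym)
    from this[of "pprt x"] this[of "- nprt x"]
    have "dual_apply f (pprt x + nprt x) = dual_apply g (pprt x + nprt x)" by simp
    then show "dual_apply f x = dual_apply g x" by (simp flip: prts)
  qed
  show "h + f \<le> h + g" if "f \<le> g" using that by (simp add: less_eq_dual_def)
  show "a *\<^sub>R f \<le> a *\<^sub>R g" if "f \<le> g" "0 \<le> a"
    using that by (simp add: less_eq_dual_def mult_left_mono)
  show "a *\<^sub>R f \<le> b *\<^sub>R f" if "a \<le> b" "0 \<le> f"
    using that by (simp add: less_eq_dual_def mult_right_mono)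
  show "inf f g \<le> f" using pprt_ge(2)[of "f - g"] by (simp add: inf_dual_def less_eq_dual_def)
  show "inf f g \<le> g" using pprt_ge(1)[of "f - g"]
    by (simp add: inf_dual_def less_eq_dual_def algebra_simps)
  show "f \<le> inf g h" if "f \<le> g" "f \<le> h"
    using pprt_le[of "g - h" "g - f"] that
    by (simp add: inf_dual_def less_eq_dual_def algebra_simps)
  show "f \<le> sup f g" using pprt_ge(2)[of "g - f"] by (simp add: sup_dual_def less_eq_dual_def)
  show "g \<le> sup f g" using pprt_ge(1)[of "g - f"]
    by (simp add: sup_dual_def less_eq_dual_def algebra_simps)
  show "sup g h \<le> f" if "g \<le> f" "h \<le> f"
    using pprt_le[of "h - g" "f - g"] that
    by (simp add: sup_dual_def less_eq_dual_def algebra_simps)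
  show "\<bar>f\<bar> = sup f (- f)" by (rule abs_dual_def)
next
  fix f g :: "'a dual"
  assume fg: "\<bar>f\<bar> \<le> \<bar>g\<bar>"
  have abs_at: "dual_apply \<bar>k\<bar> x = dual_apply k x + rk_pos (dual_apply (- k - k)) x"
    if "0 \<le> x" for k :: "'a dual" and x
    using that by (simp add: abs_dual_def sup_dual_def dual_apply_dual_pprt)
  have abs_ge: "\<bar>dual_apply k x\<bar> \<le> dual_apply \<bar>k\<bar> x" if "0 \<le> x" for k :: "'a dual" and x
    using that rk_nonneg[OF that, of "- k - k"] rk_upper[of x x "- k - k"]
    by (simp add: abs_at)
  show "norm f \<le> norm g"
  proof (rule norm_dual_bound)
    fix x :: 'a
    have "\<bar>dual_apply f x\<bar> = \<bar>dual_apply f (pprt x) - dual_apply f (- nprt x)\<bar>"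
      by (subst prts[of x]) simp
    also have "\<dots> \<le> dual_apply \<bar>f\<bar> (pprt x) + dual_apply \<bar>f\<bar> (- nprt x)"
      using abs_ge[of "pprt x" f] abs_ge[of "- nprt x" f] by simp
    also have "\<dots> = dual_apply \<bar>f\<bar> \<bar>x\<bar>" by (simp add: abs_prts)
    also have "\<dots> \<le> dual_apply \<bar>g\<bar> \<bar>x\<bar>" using fg by (simp add: less_eq_dual_def)
    also have "\<dots> = dual_apply g \<bar>x\<bar> + rk_pos (dual_apply (- g - g)) \<bar>x\<bar>" by (simp add: abs_at)
    also have "\<dots> \<le> norm g * norm x"
    proof -
      have "rk_pos (dual_apply (- g - g)) \<bar>x\<bar> \<le> norm g * norm x - dual_apply g \<bar>x\<bar>"
      proof (rule rk_least)
        fix y assume y: "0 \<le> y" "y \<le> \<bar>x\<bar>"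
        have "\<bar>x\<bar> - y - y \<le> \<bar>x\<bar>" "- (\<bar>x\<bar> - y - y) \<le> \<bar>x\<bar>"
          using y add_mono[OF y(2) y(2)] add_mono[OF y(1) y(1)] by (simp_all add: algebra_simps)
        then have "\<bar>\<bar>x\<bar> - y - y\<bar> \<le> \<bar>x\<bar>" by (simp add: abs_lattice)
        then have "norm (\<bar>x\<bar> - y - y) \<le> norm x" by (rule norm_lattice)
        then have "norm g * norm (\<bar>x\<bar> - y - y) \<le> norm g * norm x" by (simp add: mult_left_mono)
        then show "dual_apply (- g - g) y \<le> norm g * norm x - dual_apply g \<bar>x\<bar>"
          using abs_dual_apply_le[of g "\<bar>x\<bar> - y - y"] by (simp add: algebra_simps)
      qed simp
      then show ?thesis by simp
    qed
    finally show "\<bar>dual_apply f x\<bar> \<le> norm g * norm x" .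
  qed simp
qed

end

lemma sup_dual_riesz_kantorovich:
  fixes f g :: "'a::banach_lattice dual"
  assumes "0 \<le> x"
  shows "dual_apply (sup f g) x = (SUP y\<in>{0..x}. dual_apply f (x - y) + dual_apply g y)"
proof -
  have "(SUP y\<in>{0..x}. dual_apply f (x - y) + dual_apply g y)
      = (SUP y\<in>{0..x}. dual_apply f x + dual_apply (g - f) y)"
    by (intro SUP_cong) auto
  also have "\<dots> = dual_apply f x + (SUP y\<in>{0..x}. dual_apply (g - f) y)"
    using assms rk_bdd[of "g - f" x] by (intro Sup_add_eq) auto
  finally show ?thesis
    using assms by (simp add: sup_dual_def dual_apply_dual_pprt rk_pos_def)
qed


section \<open>Nets\<close>

text \<open>
  A net is a family \<open>x\<close> on a set \<open>A\<close> directed by a preorder \<open>r\<close>; \<open>r a b\<close> means that \<open>b\<close> comes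
  after \<open>a\<close>. Sequences are covered by the filter \<^const>\<open>sequentially\<close>, cf. \<open>tails_nat\<close> below.
\<close>

definition directed_set :: "'i set \<Rightarrow> ('i \<Rightarrow> 'i \<Rightarrow> bool) \<Rightarrow> bool"
  where "directed_set A r \<longleftrightarrow> A \<noteq> {} \<and> reflp_on A r \<and> transp_on A r \<and>
    (\<forall>a\<in>A. \<forall>b\<in>A. \<exists>c\<in>A. r a c \<and> r b c)"

definition tails :: "'i set \<Rightarrow> ('i \<Rightarrow> 'i \<Rightarrow> bool) \<Rightarrow> 'i filter"
  where "tails A r = (INF a\<in>A. principal {b\<in>A. r a b})"

lemma eventually_tails:
  assumes "directed_set A r"
  shows "eventually P (tails A r) \<longleftrightarrow> (\<exists>a\<in>A. \<forall>b\<in>A. r a b \<longrightarrow> P b)"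
proof -
  have "eventually P (tails A r) \<longleftrightarrow> (\<exists>a\<in>A. eventually P (principal {b\<in>A. r a b}))"
    unfolding tails_def
  proof (rule eventually_INF_base)
    show "A \<noteq> {}" using assms by (simp add: directed_set_def)
    fix a b assume ab: "a \<in> A" "b \<in> A"
    then obtain c where c: "c \<in> A" "r a c" "r b c"
      using assms by (auto simp: directed_set_def)
    have "transp_on A r" using assms by (simp add: directed_set_def)
    then have "{d\<in>A. r c d} \<subseteq> {d\<in>A. r a d} \<inter> {d\<in>A. r b d}"
      using ab c by (auto dest: transp_onD)
    then show "\<exists>c\<in>A. principal {d\<in>A. r c d}
        \<le> inf (principal {d\<in>A. r a d}) (principal {d\<in>A. r b d})"
      using c by auto
  qed
  then show ?thesis by (auto simp: eventually_principal)
qed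

lemma tails_nat: "tails (UNIV :: nat set) (\<le>) = sequentially"
  by (simp add: tails_def at_top_def atLeast_def)

definition decreasing_to_zero :: "'i set \<Rightarrow> ('i \<Rightarrow> 'i \<Rightarrow> bool) \<Rightarrow> ('i \<Rightarrow> 'x::banach_lattice) \<Rightarrow> bool"
  where "decreasing_to_zero A r y \<longleftrightarrow>
    (\<forall>a\<in>A. \<forall>b\<in>A. r a b \<longrightarrow> y b \<le> y a) \<and>
    (\<forall>a\<in>A. 0 \<le> y a) \<and> (\<forall>z. (\<forall>a\<in>A. z \<le> y a) \<longrightarrow> z \<le> 0)"

text \<open>
  HOL cannot quantify over the index types of nets inside a formula. A net decreasing to \<open>0\<close> can
  be re-indexed by its range, with the reverse order of the space, so the space itself is
  large enough to index the nets that decrease to \<open>0\<close>, here and in \<open>order_continuous_norm\<close>.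
\<close>

definition order_tendsto ::
    "('i \<Rightarrow> 'x::banach_lattice) \<Rightarrow> 'x \<Rightarrow> 'i filter \<Rightarrow> bool"
  where "order_tendsto x l F \<longleftrightarrow>
    (\<exists>(B :: 'x set) r (y :: 'x \<Rightarrow> 'x). directed_set B r \<and> decreasing_to_zero B r y \<and>
      (\<forall>b\<in>B. eventually (\<lambda>a. \<bar>x a - l\<bar> \<le> y b) F))"

definition order_continuous_norm :: "'x::banach_lattice itself \<Rightarrow> bool"
  where "order_continuous_norm _ \<longleftrightarrow>
    (\<forall>(B :: 'x set) r (y :: 'x \<Rightarrow> 'x). directed_set B r \<and> decreasing_to_zero B r y \<longrightarrow>
      ((\<lambda>b. norm (y b)) \<longlongrightarrow> 0) (tails B r))"

definition disjoint_net :: "'i set \<Rightarrow> ('i \<Rightarrow> 'x::banach_lattice) \<Rightarrow> bool"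
  where "disjoint_net A x \<longleftrightarrow> (\<forall>a\<in>A. \<forall>b\<in>A. a \<noteq> b \<longrightarrow> inf \<bar>x a\<bar> \<bar>x b\<bar> = 0)"

definition uo_null :: "('i \<Rightarrow> 'x::banach_lattice) \<Rightarrow> 'i filter \<Rightarrow> bool"
  where "uo_null x F \<longleftrightarrow> (\<forall>u\<ge>0. order_tendsto (\<lambda>a. inf \<bar>x a\<bar> u) 0 F)"

definition un_null :: "('i \<Rightarrow> 'x::banach_lattice) \<Rightarrow> 'i filter \<Rightarrow> bool"
  where "un_null x F \<longleftrightarrow> (\<forall>u\<ge>0. ((\<lambda>a. inf \<bar>x a\<bar> u) \<longlongrightarrow> 0) F)"

definition uaw_null :: "('i \<Rightarrow> 'x::banach_lattice) \<Rightarrow> 'i filter \<Rightarrow> bool"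
  where "uaw_null x F \<longleftrightarrow>
    (\<forall>u\<ge>0. \<forall>f. bounded_linear f \<longrightarrow> ((\<lambda>a. f (inf \<bar>x a\<bar> u) :: real) \<longlongrightarrow> 0) F)"

definition uaws_null :: "('i \<Rightarrow> 'e::banach_lattice dual) \<Rightarrow> 'i filter \<Rightarrow> bool"
  where "uaws_null x' F \<longleftrightarrow>
    (\<forall>u'\<ge>0. \<forall>e. ((\<lambda>a. dual_apply (inf \<bar>x' a\<bar> u') e) \<longlongrightarrow> 0) F)"


section \<open>The unbounded duals\<close>

text \<open>
  The type argument supplies the index universe: the nets are those indexed by arbitrary
  directed subsets of \<open>'i\<close>. A statement polymorphic in \<open>'i\<close> ranges over all nets; an infinite
  \<open>'i\<close> is needed for sequences to be among them.
\<close>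

definition uo_dual :: "'i itself \<Rightarrow> ('x::banach_lattice \<Rightarrow> real) set"
  where "uo_dual _ = {f. linear f \<and>
    (\<forall>(A :: 'i set) r x. directed_set A r \<and> bounded (x ` A) \<and> uo_null x (tails A r) \<longrightarrow>
      ((\<lambda>a. f (x a)) \<longlongrightarrow> 0) (tails A r))}"

definition un_dual :: "'i itself \<Rightarrow> ('x::banach_lattice \<Rightarrow> real) set"
  where "un_dual _ = {f. bounded_linear f \<and>
    (\<forall>(A :: 'i set) r x. directed_set A r \<and> bounded (x ` A) \<and> un_null x (tails A r) \<longrightarrow>
      ((\<lambda>a. f (x a)) \<longlongrightarrow> 0) (tails A r))}"

definition uaw_dual :: "'i itself \<Rightarrow> ('x::banach_lattice \<Rightarrow> real) set"
  where "uaw_dual _ = {f. bounded_linear f \<and>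
    (\<forall>(A :: 'i set) r x. directed_set A r \<and> bounded (x ` A) \<and> uaw_null x (tails A r) \<longrightarrow>
      ((\<lambda>a. f (x a)) \<longlongrightarrow> 0) (tails A r))}"

definition uaws_dual :: "'i itself \<Rightarrow> ('e::banach_lattice dual \<Rightarrow> real) set"
  where "uaws_dual _ = {f. bounded_linear f \<and>
    (\<forall>(A :: 'i set) r x. directed_set A r \<and> bounded (x ` A) \<and> uaws_null x (tails A r) \<longrightarrow>
      ((\<lambda>a. f (x a)) \<longlongrightarrow> 0) (tails A r))}"

text \<open>
  Directed sets with a greatest element are excluded for disjoint nets: every vector, as a net
  with a one-point index set, would be a disjoint net, and only the zero functional would remain.
\<close>

definition d_dual :: "'i itself \<Rightarrow> ('x::banach_lattice \<Rightarrow> real) set"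
  where "d_dual _ = {f. bounded_linear f \<and>
    (\<forall>(A :: 'i set) r x. directed_set A r \<and> (\<nexists>m. m \<in> A \<and> (\<forall>a\<in>A. r a m)) \<and>
      bounded (x ` A) \<and> disjoint_net A x \<longrightarrow>
      ((\<lambda>a. f (x a)) \<longlongrightarrow> 0) (tails A r))}"

definition eval_functional :: "'e::banach_lattice \<Rightarrow> 'e dual \<Rightarrow> real"
  where "eval_functional x x' = dual_apply x' x"

definition all_equivalent :: "bool list \<Rightarrow> bool"
  where "all_equivalent ps \<longleftrightarrow> (\<forall>p\<in>set ps. \<forall>q\<in>set ps. p \<longleftrightarrow> q)"

end

theory Submission
  imports Defs
begin

text \<open>
  Write \<open>w = \<bar>x\<bar>\<close>. All notions of null net in the dual imply \<open>uaw*\<close>-convergence: for \<open>un\<close>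
  and \<open>uaw\<close> this is immediate, for \<open>uo\<close> it holds because infima of decreasing nets in a dual are
  pointwise (\<open>uo_null_imp_uaws_null\<close>). In the other direction, disjoint sequences are null in the
  senses \<open>uo\<close>, \<open>uaw\<close> and \<open>uaw*\<close> (\<open>disjoint_net_uo_null\<close>, \<open>disjoint_net_uaw_null\<close>). The condition on
  \<open>uaw*\<close>-null nets is therefore the strongest of the first eight, the one on disjoint sequences the
  weakest, and it suffices to link these two with the condition on the interval \<open>{0..w}\<close>.

  Disjoint functionals control disjoint vectors: given a disjoint sequence in \<open>{0..x\<^sup>+}\<close>, choose norming
  functionals carried by its members (\<open>exists_carried_norming_functional\<close>). They are disjoint and
  bounded, and they dominate the norms of the members when evaluated at \<open>x\<close>.

  Conversely, suppose that disjoint sequences in \<open>{0..w}\<close> are norm null. Then increasing sequences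
  in \<open>{0..w}\<close> converge in norm, because their increments are dominated, up to a small multiple of
  \<open>w\<close>, by the crossings of finitely many levels, which form disjoint sequences
  (\<open>diff_le_level_crossings\<close>). Norm limits thus provide countable suprema in \<open>{0..w}\<close>, and a gliding
  hump argument with tail suprema shows that bounded sets of functionals can be truncated uniformly
  at \<open>w\<close>: for all \<open>\<epsilon>\<close> and \<open>M\<close> there is \<open>u\<close> such that \<open>(f - u)\<^sup>+\<close> is at most
  \<open>\<epsilon>\<close> at \<open>w\<close> for each \<open>f \<ge> 0\<close> of norm at most \<open>M\<close> (\<open>uniform_truncation\<close>). The
  remaining part \<open>inf \<bar>x' a\<bar> u\<close> of a \<open>uaw*\<close>-null net tends to zero at \<open>w\<close> by definition.

  If the dual has order continuous norm, then \<open>uo\<close>-null sequences are \<open>un\<close>-null, so the two further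
  conditions lie between the strongest one and the one on \<open>uo\<close>-null sequences.

  Positive functionals are obtained from a Hahn--Banach theorem for sublinear functionals.
\<close>

section \<open>Riesz space arithmetic\<close>

lemma scaleR_le_iff:
  fixes x y :: "'a::ordered_real_vector"
  assumes "0 < c"
  shows "c *\<^sub>R x \<le> y \<longleftrightarrow> x \<le> (1 / c) *\<^sub>R y"
proof
  assume "c *\<^sub>R x \<le> y"
  then have "(1 / c) *\<^sub>R (c *\<^sub>R x) \<le> (1 / c) *\<^sub>R y"
    using assms by (intro scaleR_left_mono) auto
  then show "x \<le> (1 / c) *\<^sub>R y" using assms by simp
next
  assume "x \<le> (1 / c) *\<^sub>R y"
  then have "c *\<^sub>R x \<le> c *\<^sub>R ((1 / c) *\<^sub>R y)"
    using assms by (intro scaleR_left_mono) auto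
  then show "c *\<^sub>R x \<le> y" using assms by simp
qed

lemma scaleR_inf:
  fixes x y :: "'a::banach_lattice"
  assumes "0 < c"
  shows "c *\<^sub>R inf x y = inf (c *\<^sub>R x) (c *\<^sub>R y)"
proof (rule antisym)
  show "c *\<^sub>R inf x y \<le> inf (c *\<^sub>R x) (c *\<^sub>R y)"
    using assms by (auto intro!: scaleR_left_mono)
  have "(1 / c) *\<^sub>R inf (c *\<^sub>R x) (c *\<^sub>R y) \<le> inf x y"
    using assms scaleR_le_iff[of "1 / c" "inf (c *\<^sub>R x) (c *\<^sub>R y)"] by simp
  then show "inf (c *\<^sub>R x) (c *\<^sub>R y) \<le> c *\<^sub>R inf x y"
    using assms scaleR_le_iff[of "1 / c" "inf (c *\<^sub>R x) (c *\<^sub>R y)" "inf x y"]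
    by (simp del: le_inf_iff inf.bounded_iff)
qed

lemma pprt_scaleR:
  fixes x :: "'a::banach_lattice"
  assumes "0 < c"
  shows "pprt (c *\<^sub>R x) = c *\<^sub>R pprt x"
proof -
  have "c *\<^sub>R inf (- x) 0 = inf (c *\<^sub>R (- x)) (c *\<^sub>R 0)" using assms by (rule scaleR_inf)
  then have "- inf (- (c *\<^sub>R x)) 0 = c *\<^sub>R (- inf (- x) 0)"
    by (simp only: scaleR_minus_right scaleR_zero_right)
  moreover have "pprt z = - inf (- z) 0" for z :: 'a
    by (simp only: pprt_def neg_inf_eq_sup minus_minus minus_zero)
  ultimately show ?thesis by (simp only:)
qed

lemma pprt_add_le:
  fixes x y :: "'a::lattice_ab_group_add"
  shows "pprt (x + y) \<le> pprt x + pprt y"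
proof -
  have "x \<le> pprt x" "y \<le> pprt y" by (simp_all add: pprt_def)
  moreover have "0 \<le> pprt x + pprt y" by simp
  ultimately show ?thesis by (simp add: pprt_def add_mono)
qed

lemma pprt_diff_eq_diff_inf:
  fixes x y :: "'a::lattice_ab_group_add"
  shows "pprt (x - y) = x - inf x y"
  by (simp add: pprt_def diff_inf_eq_sup add_sup_distrib_left sup_commute)

lemma inf_add_le:
  fixes a b c :: "'a::lattice_ab_group_add"
  assumes "0 \<le> b" "0 \<le> c" "0 \<le> a"
  shows "inf a (b + c) \<le> inf a b + inf a c"
proof -
  have "inf a (b + c) \<le> a + a" using assms by (simp add: le_infI1)
  moreover have "inf a (b + c) \<le> a + c" "inf a (b + c) \<le> b + a"
    using assms by (simp_all add: le_infI1)
  ultimately have "inf a (b + c) \<le> inf (inf (a + a) (b + a)) (inf (a + c) (b + c))"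
    by simp
  also have "\<dots> = inf a b + inf a c"
    by (simp add: add_inf_distrib_left add_inf_distrib_right)
  finally show ?thesis .
qed

lemma inf_pprt_eq_0:
  fixes x y :: "'a::lattice_ab_group_add"
  shows "inf (pprt (x - y)) (pprt (y - x)) = 0"
proof -
  have "inf (pprt (x - y)) (pprt (y - x)) = inf (x - inf x y) (y - inf x y)"
    by (simp only: pprt_diff_eq_diff_inf inf_commute)
  also have "\<dots> = inf x y - inf x y" by (simp only: diff_conv_add_uminus add_inf_distrib_right)
  finally show ?thesis by simp
qed

lemma inf_eq_0_mono:
  fixes a b :: "'a::lattice_ab_group_add"
  assumes "inf a b = 0" "0 \<le> a'" "a' \<le> a" "0 \<le> b'" "b' \<le> b"
  shows "inf a' b' = 0"
proof (rule antisym)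
  show "inf a' b' \<le> 0" using inf_mono[OF assms(3,5)] assms(1) by simp
qed (use assms in simp)

lemma add_le_of_inf_eq_0:
  fixes a b :: "'a::lattice_ab_group_add"
  assumes "inf a b = 0" "a \<le> c" "b \<le> c"
  shows "a + b \<le> c"
  using assms add_eq_inf_sup[of a b] by simp

lemma inf_scaleR_eq_0:
  fixes a b :: "'a::banach_lattice"
  assumes "inf a b = 0" "0 \<le> a" "0 \<le> b" "0 \<le> c"
  shows "inf a (c *\<^sub>R b) = 0"
proof (rule inf_eq_0_mono)
  let ?C = "max 1 c"
  show "inf (?C *\<^sub>R a) (?C *\<^sub>R b) = 0" using assms(1) scaleR_inf[of ?C a b] by simp
  show "a \<le> ?C *\<^sub>R a" using scaleR_right_mono[of 1 ?C a] assms by simp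
  show "c *\<^sub>R b \<le> ?C *\<^sub>R b" using assms by (intro scaleR_right_mono) auto
qed (use assms in \<open>auto intro: scaleR_nonneg_nonneg\<close>)

lemma norm_pprt_le:
  fixes x :: "'a::banach_lattice"
  shows "norm (pprt x) \<le> norm x"
  by (rule norm_lattice) (simp add: abs_prts)


text \<open>
  The Archimedean property; it holds in a Banach lattice because the norm is monotone.
\<close>

lemma eq_0_if_multiples_bounded:
  fixes t y :: "'a::banach_lattice"
  assumes "0 \<le> t" and le: "\<And>n::nat. real n *\<^sub>R t \<le> y"
  shows "t = 0"
proof (rule ccontr)
  assume "t \<noteq> 0"
  then obtain n :: nat where n: "norm y < real n * norm t"
    using reals_Archimedean3[of "norm t"] by auto
  have "norm (real n *\<^sub>R t) \<le> norm y"
    using assms by (intro banach_lattice_norm_mono) (auto intro: scaleR_nonneg_nonneg)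
  with n show False by simp
qed

text \<open>
  The positive cone is closed because \<open>(- L)\<^sup>+ \<le> \<bar>X n - L\<bar>\<close> whenever \<open>X n \<ge> 0\<close>.
\<close>

lemma Lim_nonneg:
  fixes X :: "nat \<Rightarrow> 'a::banach_lattice"
  assumes "X \<longlonglongrightarrow> L" "\<And>n. 0 \<le> X n"
  shows "0 \<le> L"
proof -
  have "norm (pprt (- L)) \<le> norm (X n - L)" for n
  proof -
    have "pprt (- L) \<le> pprt (X n - L)" using assms(2)[of n] by (intro pprt_mono) simp
    then show ?thesis
      using norm_pprt_le[of "X n - L"] banach_lattice_norm_mono[of "pprt (- L)"]
      by (meson order_trans zero_le_pprt)
  qed
  moreover have "(\<lambda>n. norm (X n - L)) \<longlonglongrightarrow> 0"
    using assms(1) by (simp add: LIM_zero tendsto_norm_zero)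
  ultimately have "norm (pprt (- L)) \<le> 0" by (meson LIMSEQ_le_const)
  then have "pprt (- L) = 0" by simp
  then show ?thesis by (simp flip: le_zero_iff_zero_pprt)
qed

lemma Lim_le_Lim:
  fixes X :: "nat \<Rightarrow> 'a::banach_lattice"
  assumes "X \<longlonglongrightarrow> L" "Y \<longlonglongrightarrow> M" "\<forall>\<^sub>F n in sequentially. X n \<le> Y n"
  shows "L \<le> M"
proof -
  obtain N where N: "\<And>n. N \<le> n \<Longrightarrow> X n \<le> Y n"
    using assms(3) by (auto simp: eventually_sequentially)
  have "(\<lambda>n. Y (n + N) - X (n + N)) \<longlonglongrightarrow> M - L"
    using assms by (intro tendsto_diff LIMSEQ_ignore_initial_segment)
  then have "0 \<le> M - L" by (rule Lim_nonneg) (simp add: N)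
  then show ?thesis by simp
qed

section \<open>Functionals in the norm dual\<close>

lemma dual_le_iff: "f \<le> g \<longleftrightarrow> (\<forall>e\<ge>0. dual_apply f e \<le> dual_apply g e)"
  by (rule less_eq_dual_def)

lemma dual_apply_nonneg: "0 \<le> f \<Longrightarrow> 0 \<le> e \<Longrightarrow> 0 \<le> dual_apply f e"
  by (auto simp: dual_le_iff)

lemma dual_apply_mono: "0 \<le> f \<Longrightarrow> e \<le> e' \<Longrightarrow> dual_apply f e \<le> dual_apply f e'"
  using dual_apply_nonneg[of f "e' - e"] by simp

lemma bounded_linear_eval: "bounded_linear (eval_functional e)"
  by (rule bounded_linear_intro[where K = "norm e"])
    (auto simp: eval_functional_def abs_dual_apply_le)

lemma abs_dual_apply_le_abs: "\<bar>dual_apply f e\<bar> \<le> dual_apply \<bar>f\<bar> \<bar>e\<bar>"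
proof -
  have pos: "\<bar>dual_apply f a\<bar> \<le> dual_apply \<bar>f\<bar> a" if "0 \<le> a" for a
  proof -
    have "f \<le> \<bar>f\<bar>" "- f \<le> \<bar>f\<bar>" by (simp_all add: abs_ge_self abs_ge_minus_self)
    then have "dual_apply f a \<le> dual_apply \<bar>f\<bar> a" "dual_apply (- f) a \<le> dual_apply \<bar>f\<bar> a"
      using that unfolding dual_le_iff by blast+
    then show ?thesis by simp
  qed
  have "\<bar>dual_apply f e\<bar> = \<bar>dual_apply f (pprt e) - dual_apply f (- nprt e)\<bar>"
    by (subst prts[of e]) simp
  also have "\<dots> \<le> dual_apply \<bar>f\<bar> (pprt e) + dual_apply \<bar>f\<bar> (- nprt e)"
    using pos[of "pprt e"] pos[of "- nprt e"] by simp
  also have "\<dots> = dual_apply \<bar>f\<bar> \<bar>e\<bar>" by (simp add: abs_prts)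
  finally show ?thesis .
qed

text \<open>
  The value of \<open>(f - u)\<^sup>+\<close> at \<open>w\<close> is a supremum over the interval below \<open>w\<close>, by the
  Riesz--Kantorovich formula, so a strict lower bound of it is exceeded at a point of the interval.
\<close>

lemma dual_pprt_diff_gt:
  assumes "0 \<le> w" "\<epsilon> < dual_apply (pprt (f - u)) w"
  shows "\<exists>y. 0 \<le> y \<and> y \<le> w \<and> dual_apply u y + \<epsilon> < dual_apply f y"
proof -
  have "\<epsilon> < (SUP y\<in>{0..w}. dual_apply (f - u) (w - y) + dual_apply 0 y)"
    using assms by (simp only: pprt_def sup_dual_riesz_kantorovich)
  moreover have "(\<lambda>y. dual_apply (f - u) (w - y) + dual_apply 0 y) ` {0..w} \<noteq> {}"
    using assms by auto
  ultimately obtain y where y: "y \<in> {0..w}" "\<epsilon> < dual_apply (f - u) (w - y) + dual_apply 0 y"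
    by (metis (mono_tags, lifting) imageE less_cSupE)
  then show ?thesis
    by (intro exI[of _ "w - y"]) auto
qed

text \<open>
  Disjointness in the dual is tested by splitting each positive vector into a piece on which \<open>f\<close> is
  small and a piece on which \<open>g\<close> is small, since \<open>inf f g\<close> lies below both.
\<close>

lemma dual_inf_eq_0I:
  assumes "0 \<le> f" "0 \<le> g"
    and small: "\<And>w \<epsilon>. 0 \<le> w \<Longrightarrow> 0 < \<epsilon> \<Longrightarrow>
      \<exists>y. 0 \<le> y \<and> y \<le> w \<and> dual_apply f y + dual_apply g (w - y) \<le> \<epsilon>"
  shows "inf f g = 0"
proof (rule antisym)
  show "inf f g \<le> 0"
    unfolding dual_le_iff
  proof (intro allI impI, rule field_le_epsilon)
    fix w :: 'a and \<epsilon> :: real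
    assume w: "0 \<le> w" and "0 < \<epsilon>"
    then obtain y where y: "0 \<le> y" "y \<le> w" "dual_apply f y + dual_apply g (w - y) \<le> \<epsilon>"
      using small by blast
    have "inf f g \<le> f" "inf f g \<le> g" by simp_all
    moreover have "0 \<le> w - y" using y by simp
    ultimately have "dual_apply (inf f g) y \<le> dual_apply f y"
      "dual_apply (inf f g) (w - y) \<le> dual_apply g (w - y)"
      using y(1) unfolding dual_le_iff by blast+
    then show "dual_apply (inf f g) w \<le> dual_apply 0 w + \<epsilon>" using y(3) by simp
  qed
qed (use assms in simp)

section \<open>The Hahn-Banach theorem for positive functionals\<close>

text \<open>
  Homogeneity is required as an inequality for \<open>c > 0\<close> only; applied to \<open>1 / c\<close> it yields the
  equality, and this form is the easier one to verify for suprema and infima.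
\<close>

definition sublinear :: "('a::real_vector \<Rightarrow> real) \<Rightarrow> bool"
  where "sublinear p \<longleftrightarrow> (\<forall>x y. p (x + y) \<le> p x + p y) \<and> (\<forall>c>0. \<forall>x. p (c *\<^sub>R x) \<le> c * p x)"

lemma sublinearD:
  assumes "sublinear p"
  shows "p (x + y) \<le> p x + p y" and "0 \<le> c \<Longrightarrow> p (c *\<^sub>R x) = c * p x"
    and "p 0 = 0" and "- p (- x) \<le> p x"
proof -
  have hom: "p (c *\<^sub>R x) \<le> c * p x" if "0 < c" for c x
    using assms that by (auto simp: sublinear_def)
  have add: "p (x + y) \<le> p x + p y" for x y using assms by (auto simp: sublinear_def)
  then show "p (x + y) \<le> p x + p y" .
  show 0: "p 0 = 0" using hom[of "1/2" 0] add[of 0 0] by simp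
  show "p (c *\<^sub>R x) = c * p x" if "0 \<le> c"
  proof (cases "c = 0")
    case False
    then have "0 < c" using that by simp
    then show ?thesis using hom[of c x] hom[of "1/c" "c *\<^sub>R x"] by (simp add: field_simps)
  qed (use 0 in simp)
  show "- p (- x) \<le> p x" using add[of x "- x"] 0 by simp
qed

text \<open>
  This is the largest sublinear \<open>q \<le> p\<close> with \<open>q (- y) \<le> - p y\<close>. It forces any linear functional
  below it to take the value \<open>p y\<close> at \<open>y\<close>.
\<close>

definition pull_down :: "('a::real_vector \<Rightarrow> real) \<Rightarrow> 'a \<Rightarrow> 'a \<Rightarrow> real"
  where "pull_down p y x = (INF t\<in>{0..}. p (x + t *\<^sub>R y) - t * p y)"

lemma pull_down_le:
  assumes "sublinear p" "0 \<le> t"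
  shows "pull_down p y x \<le> p (x + t *\<^sub>R y) - t * p y"
proof -
  have "bdd_below ((\<lambda>t. p (x + t *\<^sub>R y) - t * p y) ` {0..})"
  proof (rule bdd_belowI2)
    fix t :: real assume "t \<in> {0..}"
    then have "t * p y = p (- x + (x + t *\<^sub>R y))" using sublinearD(2)[OF assms(1)] by simp
    also have "\<dots> \<le> p (- x) + p (x + t *\<^sub>R y)" by (rule sublinearD(1)[OF assms(1)])
    finally show "- p (- x) \<le> p (x + t *\<^sub>R y) - t * p y" by simp
  qed
  then show ?thesis unfolding pull_down_def using assms by (intro cINF_lower) auto
qed

lemma le_pull_down:
  "(\<And>t. 0 \<le> t \<Longrightarrow> b \<le> p (x + t *\<^sub>R y) - t * p y) \<Longrightarrow> b \<le> pull_down p y x"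
  unfolding pull_down_def by (rule cINF_greatest) auto

lemma sublinear_pull_down:
  assumes p: "sublinear p"
  shows "sublinear (pull_down p y)"
  unfolding sublinear_def
proof (intro conjI allI impI)
  fix u v
  have "pull_down p y (u + v) - pull_down p y v \<le> p (u + s *\<^sub>R y) - s * p y" if s: "0 \<le> s" for s
  proof -
    have "pull_down p y (u + v) - (p (u + s *\<^sub>R y) - s * p y) \<le> pull_down p y v"
    proof (rule le_pull_down)
      fix t :: real assume t: "0 \<le> t"
      have "pull_down p y (u + v) \<le> p ((u + v) + (s + t) *\<^sub>R y) - (s + t) * p y"
        using s t by (intro pull_down_le[OF p]) simp
      moreover have "p ((u + v) + (s + t) *\<^sub>R y) \<le> p (u + s *\<^sub>R y) + p (v + t *\<^sub>R y)"
        using sublinearD(1)[OF p, of "u + s *\<^sub>R y" "v + t *\<^sub>R y"] by (simp add: algebra_simps)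
      ultimately show "pull_down p y (u + v) - (p (u + s *\<^sub>R y) - s * p y)
          \<le> p (v + t *\<^sub>R y) - t * p y" by (simp add: algebra_simps)
    qed
    then show ?thesis by simp
  qed
  then have "pull_down p y (u + v) - pull_down p y v \<le> pull_down p y u" by (rule le_pull_down)
  then show "pull_down p y (u + v) \<le> pull_down p y u + pull_down p y v" by simp
next
  fix c :: real and x assume c: "0 < c"
  have "pull_down p y (c *\<^sub>R x) / c \<le> pull_down p y x"
  proof (rule le_pull_down)
    fix t :: real assume t: "0 \<le> t"
    have "pull_down p y (c *\<^sub>R x) \<le> p (c *\<^sub>R x + (c * t) *\<^sub>R y) - (c * t) * p y"
      using c t by (intro pull_down_le[OF p]) simp
    also have "c *\<^sub>R x + (c * t) *\<^sub>R y = c *\<^sub>R (x + t *\<^sub>R y)" by (simp add: scaleR_add_right)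
    also have "p \<dots> = c * p (x + t *\<^sub>R y)" using c by (intro sublinearD(2)[OF p]) simp
    finally show "pull_down p y (c *\<^sub>R x) / c \<le> p (x + t *\<^sub>R y) - t * p y"
      using c by (simp add: field_simps)
  qed
  then show "pull_down p y (c *\<^sub>R x) \<le> c * pull_down p y x" using c by (simp add: field_simps)
qed

text \<open>
  Pulling a minimal \<open>q\<close> down along \<open>y\<close> cannot change it, and this invariance is superadditivity
  of \<open>q\<close> in the direction \<open>y\<close>.
\<close>

lemma minimal_sublinear_linear:
  assumes q: "sublinear q"
    and min: "\<And>r. sublinear r \<Longrightarrow> (\<And>x. r x \<le> q x) \<Longrightarrow> r = q"
  shows "linear q"
proof -
  have add: "q (x + y) = q x + q y" for x y
  proof -
    have "pull_down q y x \<le> q x" for x using pull_down_le[OF q, of 0 y x] by simp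
    then have "pull_down q y = q" by (intro min sublinear_pull_down q)
    moreover have "pull_down q y x \<le> q (x + y) - q y" using pull_down_le[OF q, of 1 y x] by simp
    ultimately have "q x \<le> q (x + y) - q y" by simp
    with sublinearD(1)[OF q, of x y] show ?thesis by simp
  qed
  have neg: "q (- x) = - q x" for x using add[of x "- x"] sublinearD(3)[OF q] by simp
  show ?thesis
  proof (rule linearI)
    fix c :: real and x
    show "q (c *\<^sub>R x) = c *\<^sub>R q x"
      using sublinearD(2)[OF q, of c x] sublinearD(2)[OF q, of "- c" x] neg[of "c *\<^sub>R x"]
      by (cases "0 \<le> c") auto
  qed (rule add)
qed

text \<open>
  By Zorn's lemma: the pointwise infimum of a chain of sublinear functionals below \<open>p\<close> is
  sublinear, and it is finite because each of them is bounded below by \<open>- p (- x)\<close>.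
\<close>

lemma exists_minimal_sublinear:
  assumes p: "sublinear p"
  shows "\<exists>q. sublinear q \<and> (\<forall>x. q x \<le> p x) \<and>
    (\<forall>r. sublinear r \<and> (\<forall>x. r x \<le> q x) \<longrightarrow> r = q)"
proof -
  define A where "A = {q. sublinear q \<and> (\<forall>x. q x \<le> p x)}"
  define P where "P = (\<lambda>q r :: 'a \<Rightarrow> real. \<forall>x. r x \<le> q x)"
  have "\<exists>m\<in>A. \<forall>a\<in>A. P m a \<longrightarrow> a = m"
  proof (rule predicate_Zorn)
    show "partial_order_on A (relation_of P A)"
    proof (rule partial_order_on_relation_ofI)
      show "P a c" if "P a b" "P b c" for a b c
        using that unfolding P_def by (meson order_trans)
      show "a = b" if "P a b" "P b a" for a b
        using that by (auto simp: P_def fun_eq_iff intro: antisym)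
    qed (simp add: P_def)
  next
    fix C assume C: "C \<in> Chains (relation_of P A)"
    then have CA: "C \<subseteq> A" by (auto simp: Chains_def relation_of_def)
    show "\<exists>u\<in>A. \<forall>a\<in>C. P a u"
    proof (cases "C = {}")
      case True
      then show ?thesis using p by (auto simp: A_def)
    next
      case False
      define u where "u = (\<lambda>x. INF q\<in>C. q x)"
      have bdd: "bdd_below ((\<lambda>q. q x) ` C)" for x
      proof (rule bdd_belowI2)
        fix q assume "q \<in> C"
        then have "q \<in> A" using CA by auto
        then have "- q (- x) \<le> q x" "q (- x) \<le> p (- x)"
          using sublinearD(4) by (auto simp: A_def)
        then show "- p (- x) \<le> q x" by linarith
      qed
      have low: "u x \<le> q x" if "q \<in> C" for q x
        unfolding u_def by (rule cINF_lower[OF bdd that])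
      have great: "b \<le> u x" if "\<And>q. q \<in> C \<Longrightarrow> b \<le> q x" for b x
        unfolding u_def using False that by (rule cINF_greatest)
      have "sublinear u"
        unfolding sublinear_def
      proof (intro conjI allI impI)
        fix x y
        have "u (x + y) - u y \<le> q x" if q: "q \<in> C" for q
        proof -
          have "u (x + y) - q x \<le> u y"
          proof (rule great)
            fix q' assume q': "q' \<in> C"
            \<comment> \<open>the smaller of two members of the chain serves for both points\<close>
            obtain r where r: "r \<in> C" "\<And>z. r z \<le> q z" "\<And>z. r z \<le> q' z"
            proof -
              have "P q q' \<or> P q' q" using C q q' by (auto simp: Chains_def relation_of_def)
              then show thesis using that[OF q] that[OF q'] by (auto simp: P_def)
            qed
            have "u (x + y) \<le> r (x + y)" by (rule low[OF r(1)])
            also have "\<dots> \<le> r x + r y" using r(1) CA by (intro sublinearD(1)) (auto simp: A_def)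
            also have "\<dots> \<le> q x + q' y" using r by (intro add_mono)
            finally show "u (x + y) - q x \<le> q' y" by simp
          qed
          then show ?thesis by simp
        qed
        then have "u (x + y) - u y \<le> u x" by (rule great)
        then show "u (x + y) \<le> u x + u y" by simp
      next
        fix c :: real and x assume c: "0 < c"
        have "u (c *\<^sub>R x) / c \<le> u x"
        proof (rule great)
          fix q assume q: "q \<in> C"
          then have "q (c *\<^sub>R x) = c * q x"
            using CA c by (intro sublinearD(2)) (auto simp: A_def)
          then show "u (c *\<^sub>R x) / c \<le> q x"
            using low[OF q, of "c *\<^sub>R x"] c by (simp add: field_simps)
        qed
        then show "u (c *\<^sub>R x) \<le> c * u x" using c by (simp add: field_simps)
      qed
      moreover have "u x \<le> p x" for x
      proof -
        obtain q where q: "q \<in> C" using False by auto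
        then have "q x \<le> p x" using CA by (auto simp: A_def)
        with low[OF q, of x] show ?thesis by simp
      qed
      ultimately have "u \<in> A" by (simp add: A_def)
      then show ?thesis using low by (auto simp: P_def)
    qed
  qed
  then obtain m where m: "m \<in> A" "\<And>a. a \<in> A \<Longrightarrow> P m a \<Longrightarrow> a = m" by blast
  have "r = m" if "sublinear r" "\<forall>x. r x \<le> m x" for r
  proof (rule m(2))
    have "r x \<le> p x" for x using that(2) m(1) order_trans[of "r x" "m x" "p x"] by (simp add: A_def)
    then show "r \<in> A" using that by (simp add: A_def)
    show "P m r" using that by (simp add: P_def)
  qed
  then show ?thesis using m(1) by (auto simp: A_def)
qed

theorem Hahn_Banach_sublinear:
  assumes p: "sublinear p"
  shows "\<exists>g. linear g \<and> (\<forall>x. g x \<le> p x) \<and> g y = p y"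
proof -
  obtain g where g: "sublinear g" "\<And>x. g x \<le> pull_down p y x"
    and min: "\<And>r. sublinear r \<Longrightarrow> (\<And>x. r x \<le> g x) \<Longrightarrow> r = g"
    using exists_minimal_sublinear[OF sublinear_pull_down[OF p]] by metis
  have lin: "linear g" by (rule minimal_sublinear_linear[OF g(1) min])
  have le: "g x \<le> p x" for x using g(2)[of x] pull_down_le[OF p, of 0 y x] by simp
  have "g (- y) \<le> p (- y + 1 *\<^sub>R y) - 1 * p y"
    using g(2)[of "- y"] pull_down_le[OF p, of 1 y "- y"] by linarith
  then have "p y \<le> g y" using sublinearD(3)[OF p] linear_neg[OF lin] by simp
  with le[of y] have "g y = p y" by simp
  with lin le show ?thesis by blast
qed

text \<open>
  A sublinear functional that factors through the positive part dominates only positive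
  functionals.
\<close>

lemma Hahn_Banach_positive:
  fixes p :: "'a::banach_lattice \<Rightarrow> real"
  assumes p: "sublinear (\<lambda>x. p (pprt x))" and "0 \<le> C"
    and bound: "\<And>x. 0 \<le> x \<Longrightarrow> p x \<le> C * norm x"
    and e: "0 \<le> e"
  shows "\<exists>g. 0 \<le> g \<and> norm g \<le> C \<and> (\<forall>x\<ge>0. dual_apply g x \<le> p x) \<and> dual_apply g e = p e"
proof -
  obtain h where h: "linear h" "\<And>x. h x \<le> p (pprt x)" "h e = p (pprt e)"
    using Hahn_Banach_sublinear[OF p] by metis
  have le: "h x \<le> C * norm x" for x
  proof -
    have "h x \<le> C * norm (pprt x)" using h(2)[of x] bound[of "pprt x"] by simp
    also have "\<dots> \<le> C * norm x" using norm_pprt_le[of x] \<open>0 \<le> C\<close> by (intro mult_left_mono)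
    finally show ?thesis .
  qed
  have abs: "\<bar>h x\<bar> \<le> C * norm x" for x
    using le[of x] le[of "- x"] linear_neg[OF h(1), of x] by simp
  have "bounded_linear h"
    using h(1) abs by (intro bounded_linear_intro[where K = C])
      (auto simp: linear_add linear_scale mult.commute)
  then obtain g where g: "dual_apply g = h" using dual_exI by blast
  have "0 \<le> h x" if "0 \<le> x" for x
    using h(2)[of "- x"] sublinearD(3)[OF p] that linear_neg[OF h(1), of x] by simp
  then have "0 \<le> g" by (simp add: dual_le_iff g)
  moreover have "norm g \<le> C" by (rule norm_dual_bound) (use \<open>0 \<le> C\<close> abs g in auto)
  moreover have "dual_apply g x \<le> p x" if "0 \<le> x" for x using h(2)[of x] that g by simp
  moreover have "dual_apply g e = p e" using h(3) e g by simp
  ultimately show ?thesis by blast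
qed

section \<open>Comparing the modes of convergence\<close>

lemma un_null_imp_uaw_null:
  fixes x :: "'i \<Rightarrow> 'x::banach_lattice"
  assumes "un_null x F"
  shows "uaw_null x F"
  unfolding uaw_null_def
proof (intro allI impI)
  fix u :: 'x and f :: "'x \<Rightarrow> real" assume "0 \<le> u" and f: "bounded_linear f"
  then have "((\<lambda>a. f (inf \<bar>x a\<bar> u)) \<longlongrightarrow> f 0) F"
    using assms by (intro bounded_linear.tendsto[OF f]) (auto simp: un_null_def)
  then show "((\<lambda>a. f (inf \<bar>x a\<bar> u)) \<longlongrightarrow> 0) F"
    using f by (simp add: linear_simps)
qed

lemma uaw_null_imp_uaws_null:
  assumes "uaw_null x' F"
  shows "uaws_null x' F"
  using assms bounded_linear_eval unfolding uaws_null_def uaw_null_def eval_functional_def[abs_def]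
  by blast

text \<open>
  The net that dominates an order null net tends to \<open>0\<close> in norm when the norm is order continuous.
\<close>

lemma order_continuous_uo_null_imp_un_null:
  fixes x :: "'i \<Rightarrow> 'x::banach_lattice"
  assumes oc: "order_continuous_norm TYPE('x)" and "uo_null x F"
  shows "un_null x F"
  unfolding un_null_def
proof (intro allI impI)
  fix u :: 'x assume u: "0 \<le> u"
  then have "order_tendsto (\<lambda>a. inf \<bar>x a\<bar> u) 0 F" using assms by (simp add: uo_null_def)
  then obtain B and r :: "'x \<Rightarrow> 'x \<Rightarrow> bool" and y :: "'x \<Rightarrow> 'x"
    where B: "directed_set B r" "decreasing_to_zero B r y"
      and dom: "\<And>b. b \<in> B \<Longrightarrow> \<forall>\<^sub>F a in F. \<bar>inf \<bar>x a\<bar> u\<bar> \<le> y b"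
    unfolding order_tendsto_def by auto
  have lim: "((\<lambda>b. norm (y b)) \<longlongrightarrow> 0) (tails B r)"
    using oc B by (auto simp: order_continuous_norm_def)
  show "((\<lambda>a. inf \<bar>x a\<bar> u) \<longlongrightarrow> 0) F"
    unfolding tendsto_iff
  proof (intro allI impI)
    fix \<epsilon> :: real assume "0 < \<epsilon>"
    then have "\<forall>\<^sub>F b in tails B r. norm (y b) < \<epsilon>"
      using lim by (auto dest!: tendstoD simp: dist_norm)
    then obtain b where b: "b \<in> B" "norm (y b) < \<epsilon>"
      using B(1) unfolding eventually_tails[OF B(1)] directed_set_def by (meson reflp_onD)
    show "\<forall>\<^sub>F a in F. dist (inf \<bar>x a\<bar> u) 0 < \<epsilon>"
      using dom[OF b(1)]
    proof eventually_elim
      case (elim a)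
      then have "norm (inf \<bar>x a\<bar> u) \<le> norm (y b)"
        by (intro norm_lattice) (meson abs_ge_self order_trans)
      with b(2) show ?case by (simp add: dist_norm)
    qed
  qed
qed

text \<open>
  In a dual, a decreasing net has infimum zero only if it has infimum zero at each positive vector.
  Otherwise the sublinear functional \<open>x \<mapsto> inf\<^sub>b y\<^sub>b (x\<^sup>+)\<close> is positive at \<open>e\<close>, and the
  Hahn--Banach theorem produces a positive functional that lies below all \<open>y\<^sub>b\<close> and does not
  vanish at \<open>e\<close>.
\<close>

lemma decreasing_functionals_pointwise_small:
  fixes y :: "'b \<Rightarrow> 'a::banach_lattice dual"
  assumes B: "directed_set B r" "decreasing_to_zero B r y" and e: "0 \<le> e" and "0 < \<epsilon>"
  shows "\<exists>b\<in>B. dual_apply (y b) e < \<epsilon>"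
proof (rule ccontr)
  assume neg: "\<not> (\<exists>b\<in>B. dual_apply (y b) e < \<epsilon>)"
  obtain b0 where b0: "b0 \<in> B" using B(1) by (auto simp: directed_set_def)
  have pos: "0 \<le> y b" if "b \<in> B" for b using B(2) that by (auto simp: decreasing_to_zero_def)
  define p where "p = (\<lambda>x. INF b\<in>B. dual_apply (y b) x)"
  have low: "p x \<le> dual_apply (y b) x" if "0 \<le> x" "b \<in> B" for x b
    unfolding p_def using that pos
    by (intro cINF_lower bdd_belowI2[where m = 0]) (auto intro: dual_apply_nonneg)
  have great: "c \<le> p x" if "\<And>b. b \<in> B \<Longrightarrow> c \<le> dual_apply (y b) x" for c x
    unfolding p_def using b0 that by (intro cINF_greatest) auto
  have "sublinear (\<lambda>x. p (pprt x))"
    unfolding sublinear_def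
  proof (intro conjI allI impI)
    fix u v :: 'a
    have "p (pprt (u + v)) - p (pprt v) \<le> p (pprt u)"
    proof (rule great)
      fix b assume b: "b \<in> B"
      have "p (pprt (u + v)) - dual_apply (y b) (pprt u) \<le> p (pprt v)"
      proof (rule great)
        fix b' assume b': "b' \<in> B"
        obtain c where c: "c \<in> B" "r b c" "r b' c"
          using B(1) b b' by (auto simp: directed_set_def)
        then have le: "y c \<le> y b" "y c \<le> y b'"
          using B(2) b b' by (auto simp: decreasing_to_zero_def)
        have "p (pprt (u + v)) \<le> dual_apply (y c) (pprt (u + v))" using c by (intro low) auto
        also have "\<dots> \<le> dual_apply (y c) (pprt u + pprt v)"
          by (intro dual_apply_mono pos c pprt_add_le)
        also have "\<dots> = dual_apply (y c) (pprt u) + dual_apply (y c) (pprt v)" by simp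
        also have "\<dots> \<le> dual_apply (y b) (pprt u) + dual_apply (y b') (pprt v)"
          using le by (intro add_mono) (auto simp: dual_le_iff)
        finally show "p (pprt (u + v)) - dual_apply (y b) (pprt u) \<le> dual_apply (y b') (pprt v)"
          by simp
      qed
      then show "p (pprt (u + v)) - p (pprt v) \<le> dual_apply (y b) (pprt u)" by simp
    qed
    then show "p (pprt (u + v)) \<le> p (pprt u) + p (pprt v)" by simp
  next
    fix c :: real and u :: 'a assume c: "0 < c"
    have "p (pprt (c *\<^sub>R u)) / c \<le> p (pprt u)"
    proof (rule great)
      fix b assume "b \<in> B"
      then have "p (pprt (c *\<^sub>R u)) \<le> dual_apply (y b) (c *\<^sub>R pprt u)"
        using low[OF zero_le_pprt, of b "c *\<^sub>R u"] c by (simp add: pprt_scaleR)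
      then show "p (pprt (c *\<^sub>R u)) / c \<le> dual_apply (y b) (pprt u)"
        using c by (simp add: field_simps)
    qed
    then show "p (pprt (c *\<^sub>R u)) \<le> c * p (pprt u)" using c by (simp add: field_simps)
  qed
  moreover have "p x \<le> norm (y b0) * norm x" if "0 \<le> x" for x
    using low[OF that b0] abs_dual_apply_le[of "y b0" x] by linarith
  ultimately obtain g where g: "\<And>x. 0 \<le> x \<Longrightarrow> dual_apply g x \<le> p x" "dual_apply g e = p e"
    using Hahn_Banach_positive[of p "norm (y b0)" e] e by auto
  have "g \<le> y b" if "b \<in> B" for b
    using g(1) low[OF _ that] by (force simp: dual_le_iff)
  then have "g \<le> 0" using B(2) by (auto simp: decreasing_to_zero_def)
  then have "dual_apply g e \<le> 0" using e by (auto simp: dual_le_iff)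
  moreover have "\<epsilon> \<le> p e" using neg by (intro great) force
  ultimately show False using g(2) \<open>0 < \<epsilon>\<close> by simp
qed

lemma order_tendsto_dual_apply:
  fixes v :: "'i \<Rightarrow> 'a::banach_lattice dual"
  assumes "order_tendsto v 0 F" and e: "0 \<le> e"
  shows "((\<lambda>a. dual_apply (v a) e) \<longlongrightarrow> 0) F"
proof -
  obtain B and r :: "'a dual \<Rightarrow> 'a dual \<Rightarrow> bool" and y :: "'a dual \<Rightarrow> 'a dual"
    where B: "directed_set B r" "decreasing_to_zero B r y"
      and dom: "\<And>b. b \<in> B \<Longrightarrow> \<forall>\<^sub>F a in F. \<bar>v a\<bar> \<le> y b"
    using assms unfolding order_tendsto_def by auto
  show ?thesis
    unfolding tendsto_iff
  proof (intro allI impI)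
    fix \<epsilon> :: real assume "0 < \<epsilon>"
    then obtain b where b: "b \<in> B" "dual_apply (y b) e < \<epsilon>"
      using decreasing_functionals_pointwise_small[OF B e] by blast
    show "\<forall>\<^sub>F a in F. dist (dual_apply (v a) e) 0 < \<epsilon>"
      using dom[OF b(1)]
    proof eventually_elim
      case (elim a)
      then have "dual_apply \<bar>v a\<bar> e \<le> dual_apply (y b) e" using e by (simp add: dual_le_iff)
      then show ?case using abs_dual_apply_le_abs[of "v a" e] e b(2) by simp
    qed
  qed
qed

lemma uo_null_imp_uaws_null:
  fixes x' :: "'i \<Rightarrow> 'e::banach_lattice dual"
  assumes "uo_null x' F"
  shows "uaws_null x' F"
  unfolding uaws_null_def
proof (intro allI impI)
  fix u' :: "'e dual" and e :: 'e assume "0 \<le> u'"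
  then have o: "order_tendsto (\<lambda>a. inf \<bar>x' a\<bar> u') 0 F" using assms by (simp add: uo_null_def)
  have "((\<lambda>a. dual_apply (inf \<bar>x' a\<bar> u') (pprt e) - dual_apply (inf \<bar>x' a\<bar> u') (- nprt e))
      \<longlongrightarrow> 0 - 0) F"
    by (intro tendsto_diff order_tendsto_dual_apply o) simp_all
  moreover have "dual_apply f (pprt e) - dual_apply f (- nprt e) = dual_apply f e" for f
    using arg_cong[OF prts[of e], of "dual_apply f"] by simp
  ultimately show "((\<lambda>a. dual_apply (inf \<bar>x' a\<bar> u') e) \<longlongrightarrow> 0) F" by simp
qed

section \<open>Disjoint families\<close>

lemma inf_sum_eq_0:
  fixes v :: "'i \<Rightarrow> 'a::lattice_ab_group_add"
  assumes "finite S" "\<And>s. s \<in> S \<Longrightarrow> inf a (v s) = 0" "0 \<le> a" "\<And>s. s \<in> S \<Longrightarrow> 0 \<le> v s"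
  shows "inf a (sum v S) = 0"
  using assms
proof (induction S)
  case (insert s S)
  have "inf a (v s + sum v S) \<le> inf a (v s) + inf a (sum v S)"
    using insert.prems by (intro inf_add_le sum_nonneg) auto
  also have "\<dots> = 0" using insert by simp
  finally have "inf a (v s + sum v S) \<le> 0" .
  moreover have "0 \<le> inf a (v s + sum v S)"
    using insert.prems by (auto intro!: add_nonneg_nonneg sum_nonneg)
  ultimately show ?case using insert.hyps by simp
qed (simp add: inf_absorb2)

lemma sum_le_of_disjoint:
  fixes v :: "'i \<Rightarrow> 'a::lattice_ab_group_add"
  assumes "finite S" "\<And>s t. s \<in> S \<Longrightarrow> t \<in> S \<Longrightarrow> s \<noteq> t \<Longrightarrow> inf (v s) (v t) = 0"
    "\<And>s. s \<in> S \<Longrightarrow> 0 \<le> v s" "\<And>s. s \<in> S \<Longrightarrow> v s \<le> u" "0 \<le> u"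
  shows "sum v S \<le> u"
  using assms
proof (induction S)
  case (insert s S)
  have "inf (v s) (sum v S) = 0"
    using insert.hyps insert.prems by (intro inf_sum_eq_0) auto
  moreover have "v s \<le> u" "sum v S \<le> u" using insert by auto
  ultimately show ?case using insert.hyps by (simp add: add_le_of_inf_eq_0)
qed simp

text \<open>
  If \<open>t\<close> is disjoint from \<open>v\<close> eventually and \<open>y\<close> dominates \<open>v\<close> eventually, then so does
  \<open>y - t\<close>, as \<open>v + t = sup v t \<le> y\<close>. Hence subtracting \<open>t\<close> preserves the set of
  eventual upper bounds of \<open>v\<close>, and each of them dominates all multiples of \<open>t\<close>.
\<close>

lemma lower_bound_disjoint_eq_0:
  fixes v :: "'i \<Rightarrow> 'x::banach_lattice"
  assumes t: "0 \<le> t"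
    and lower: "\<And>y. \<forall>\<^sub>F a in F. v a \<le> y \<Longrightarrow> 0 \<le> y \<Longrightarrow> t \<le> y"
    and disj: "\<forall>\<^sub>F a in F. inf (v a) t = 0"
    and u: "\<forall>\<^sub>F a in F. v a \<le> u" "0 \<le> u"
  shows "t = 0"
proof -
  have "real n *\<^sub>R t \<le> y" if "\<forall>\<^sub>F a in F. v a \<le> y" "0 \<le> y" for n y
    using that
  proof (induction n arbitrary: y)
    case (Suc n)
    have "t \<le> y" by (rule lower[OF Suc.prems])
    have "\<forall>\<^sub>F a in F. v a \<le> y - t"
      using Suc.prems(1) disj
    proof eventually_elim
      case (elim a)
      from add_le_of_inf_eq_0[OF elim(2,1) \<open>t \<le> y\<close>] show ?case by (simp add: algebra_simps)
    qed
    then have "real n *\<^sub>R t \<le> y - t" using \<open>t \<le> y\<close> by (intro Suc.IH) auto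
    then show ?case by (simp add: algebra_simps)
  qed simp
  then show ?thesis using u by (intro eq_0_if_multiples_bounded[OF t, of u]) auto
qed

text \<open>
  The net that witnesses order convergence is the set of all eventual upper bounds of
  \<open>v = inf \<bar>x\<bar> u\<close>, directed downwards. A positive lower bound \<open>w\<close> of it is disjoint
  from each \<open>v k\<close>, because \<open>inf (v k) w\<close> is again a lower bound and is disjoint from all other
  members of the family; then \<open>w\<close> itself is a lower bound disjoint from the family. The hypothesis \<open>leaves\<close> is
  met by the tails of a directed set without greatest element.
\<close>

lemma disjoint_net_uo_null:
  fixes x :: "'i \<Rightarrow> 'x::banach_lattice"
  assumes disj: "disjoint_net A x" and A: "\<forall>\<^sub>F a in F. a \<in> A"
    and leaves: "\<And>k. k \<in> A \<Longrightarrow> \<forall>\<^sub>F a in F. a \<noteq> k"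
  shows "uo_null x F"
  unfolding uo_null_def
proof (intro allI impI)
  fix u :: 'x assume u: "0 \<le> u"
  define v where "v = (\<lambda>a. inf \<bar>x a\<bar> u)"
  have v0: "0 \<le> v a" and vu: "v a \<le> u" for a using u by (auto simp: v_def)
  have v_disj: "inf (v a) (v b) = 0" if "a \<in> A" "b \<in> A" "a \<noteq> b" for a b
  proof (rule inf_eq_0_mono)
    show "inf \<bar>x a\<bar> \<bar>x b\<bar> = 0" using disj that by (simp add: disjoint_net_def)
    show "v a \<le> \<bar>x a\<bar>" "v b \<le> \<bar>x b\<bar>" by (simp_all add: v_def)
  qed (rule v0)+
  define B where "B = {y. 0 \<le> y \<and> (\<forall>\<^sub>F a in F. v a \<le> y)}"
  have uB: "u \<in> B" using u vu by (simp add: B_def)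
  have "z \<le> 0" if z: "\<And>y. y \<in> B \<Longrightarrow> z \<le> y" for z
  proof -
    define w where "w = pprt z"
    have w0: "0 \<le> w" and zw: "z \<le> w" by (auto simp: w_def pprt_def)
    have wle: "w \<le> y" if "\<forall>\<^sub>F a in F. v a \<le> y" "0 \<le> y" for y
      using z[of y] that by (simp add: B_def w_def pprt_def)
    \<comment> \<open>first for single members of the family, then for \<open>w\<close> itself\<close>
    have wv: "inf (v k) w = 0" if k: "k \<in> A" for k
    proof (rule lower_bound_disjoint_eq_0[where v = v and F = F and u = u])
      show "inf (v k) w \<le> y" if "\<forall>\<^sub>F a in F. v a \<le> y" "0 \<le> y" for y
        using wle[OF that] by (simp add: le_infI2)
      show "\<forall>\<^sub>F a in F. inf (v a) (inf (v k) w) = 0"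
        using A leaves[OF k]
      proof eventually_elim
        case (elim a)
        show ?case
          by (rule inf_eq_0_mono[OF v_disj[OF elim(1) k elim(2)]]) (use v0 w0 in auto)
      qed
    qed (use v0 w0 vu u in auto)
    have "w = 0"
    proof (rule lower_bound_disjoint_eq_0[OF w0, where v = v and F = F and u = u])
      show "w \<le> y" if "\<forall>\<^sub>F a in F. v a \<le> y" "0 \<le> y" for y
        using that by (rule wle)
      show "\<forall>\<^sub>F a in F. inf (v a) w = 0" using A by eventually_elim (rule wv)
    qed (use vu u in auto)
    with zw show ?thesis by simp
  qed
  then have "decreasing_to_zero B (\<ge>) id" by (auto simp: decreasing_to_zero_def B_def)
  moreover have "directed_set B (\<ge>)"
    unfolding directed_set_def
  proof (intro conjI ballI)
    show "B \<noteq> {}" using uB by auto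
    show "reflp_on B (\<ge>)" "transp_on B (\<ge>)" by (auto intro: reflp_onI transp_onI)
    fix y y' assume "y \<in> B" "y' \<in> B"
    then have "inf y y' \<in> B" by (auto simp: B_def eventually_conj_iff)
    then show "\<exists>c\<in>B. c \<le> y \<and> c \<le> y'" by (rule bexI[rotated]) simp
  qed
  moreover have "\<forall>b\<in>B. \<forall>\<^sub>F a in F. \<bar>v a - 0\<bar> \<le> id b" using v0 by (simp add: B_def)
  ultimately show "order_tendsto (\<lambda>a. inf \<bar>x a\<bar> u) 0 F"
    unfolding order_tendsto_def v_def[symmetric] by blast
qed

text \<open>
  The sum of finitely many disjoint elements of \<open>{0..u}\<close> lies below \<open>u\<close>, so a positive
  functional \<open>\<phi>\<close> exceeds \<open>\<epsilon>\<close> at no more than \<open>\<phi> u / \<epsilon>\<close> of them.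
\<close>

lemma disjoint_net_uaw_null:
  fixes x :: "'i \<Rightarrow> 'x::banach_lattice"
  assumes disj: "disjoint_net A x" and A: "\<forall>\<^sub>F a in F. a \<in> A"
    and leaves: "\<And>k. k \<in> A \<Longrightarrow> \<forall>\<^sub>F a in F. a \<noteq> k"
  shows "uaw_null x F"
  unfolding uaw_null_def
proof (intro allI impI)
  fix u :: 'x and f :: "'x \<Rightarrow> real" assume u: "0 \<le> u" and "bounded_linear f"
  then obtain f' where f': "dual_apply f' = f" using dual_exI by blast
  define \<phi> where "\<phi> = dual_apply \<bar>f'\<bar>"
  define v where "v = (\<lambda>a. inf \<bar>x a\<bar> u)"
  have v0: "0 \<le> v a" and vu: "v a \<le> u" for a using u by (auto simp: v_def)
  have v_disj: "inf (v a) (v b) = 0" if "a \<in> A" "b \<in> A" "a \<noteq> b" for a b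
  proof (rule inf_eq_0_mono)
    show "inf \<bar>x a\<bar> \<bar>x b\<bar> = 0" using disj that by (simp add: disjoint_net_def)
    show "v a \<le> \<bar>x a\<bar>" "v b \<le> \<bar>x b\<bar>" by (simp_all add: v_def)
  qed (rule v0)+
  have fin: "finite {a\<in>A. \<epsilon> \<le> \<phi> (v a)}" if \<epsilon>: "0 < \<epsilon>" for \<epsilon>
  proof (rule ccontr)
    assume "infinite {a\<in>A. \<epsilon> \<le> \<phi> (v a)}"
    moreover obtain N :: nat where N: "\<phi> u < real N * \<epsilon>"
      using reals_Archimedean3[OF \<epsilon>] by auto
    ultimately obtain S where S: "finite S" "card S = N" "S \<subseteq> {a\<in>A. \<epsilon> \<le> \<phi> (v a)}"
      by (meson infinite_arbitrarily_large)
    have "sum v S \<le> u"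
    proof (rule sum_le_of_disjoint[OF S(1) _ v0 vu u])
      show "inf (v s) (v t) = 0" if "s \<in> S" "t \<in> S" "s \<noteq> t" for s t
        using S(3) that by (intro v_disj) auto
    qed
    then have "\<phi> (sum v S) \<le> \<phi> u" unfolding \<phi>_def by (intro dual_apply_mono) auto
    moreover have "\<phi> (sum v S) = (\<Sum>a\<in>S. \<phi> (v a))"
      unfolding \<phi>_def
      using bounded_linear_dual_apply by (intro linear_sum bounded_linear.linear)
    moreover have "real (card S) * \<epsilon> \<le> (\<Sum>a\<in>S. \<phi> (v a))" using S by (intro sum_bounded_below) auto
    ultimately show False using N S(2) by simp
  qed
  show "((\<lambda>a. f (inf \<bar>x a\<bar> u)) \<longlongrightarrow> 0) F"
    unfolding tendsto_iff
  proof (intro allI impI)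
    fix \<epsilon> :: real assume "0 < \<epsilon>"
    have "\<forall>\<^sub>F a in F. \<forall>k\<in>{a\<in>A. \<epsilon> \<le> \<phi> (v a)}. a \<noteq> k"
      using fin[OF \<open>0 < \<epsilon>\<close>] leaves by (intro eventually_ball_finite) auto
    with A show "\<forall>\<^sub>F a in F. dist (f (inf \<bar>x a\<bar> u)) 0 < \<epsilon>"
    proof eventually_elim
      case (elim a)
      then have "\<phi> (v a) < \<epsilon>" by force
      then show ?case
        using abs_dual_apply_le_abs[of f' "v a"] v0[of a] by (simp add: f' \<phi>_def v_def)
    qed
  qed
qed

section \<open>Functionals carried by a vector\<close>

text \<open>
  In a function space, \<open>g\<close> is a measure and this says that \<open>g\<close> gives no mass to the set where
  \<open>z\<close> vanishes. It is stronger than vanishing on the vectors disjoint from \<open>z\<close>, and the extra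
  strength is what makes functionals carried by disjoint vectors disjoint from each other: point mass
  at a common boundary point of two disjoint supports must be excluded.
\<close>

definition carried_by :: "'a::banach_lattice dual \<Rightarrow> 'a \<Rightarrow> bool"
  where "carried_by g z \<longleftrightarrow>
    0 \<le> g \<and> (\<forall>y\<ge>0. \<forall>\<epsilon>>0. \<exists>k\<ge>0. dual_apply g (pprt (y - k *\<^sub>R z)) \<le> \<epsilon>)"

lemma carried_by_disjoint_vector:
  assumes g: "carried_by g z" and "0 \<le> z" "0 \<le> s" "inf s z = 0"
  shows "dual_apply g s = 0"
proof (rule antisym)
  show "dual_apply g s \<le> 0"
  proof (rule field_le_epsilon)
    fix \<epsilon> :: real assume "0 < \<epsilon>"
    then obtain k where k: "0 \<le> k" "dual_apply g (pprt (s - k *\<^sub>R z)) \<le> \<epsilon>"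
      using g \<open>0 \<le> s\<close> unfolding carried_by_def by blast
    have "inf s (k *\<^sub>R z) = 0" using assms k(1) by (intro inf_scaleR_eq_0)
    then show "dual_apply g s \<le> 0 + \<epsilon>" using k(2) by (simp add: pprt_diff_eq_diff_inf)
  qed
  show "0 \<le> dual_apply g s" using g \<open>0 \<le> s\<close> by (auto simp: carried_by_def intro: dual_apply_nonneg)
qed

text \<open>
  A vector \<open>w\<close> splits into \<open>(w - k z)\<^sup>+\<close>, where \<open>g\<close> is small, and \<open>inf w (k z)\<close>, which is
  disjoint from \<open>z'\<close> and on which \<open>h\<close> therefore vanishes.
\<close>

lemma carried_by_disjoint:
  assumes g: "carried_by g z" and h: "carried_by h z'" and z: "0 \<le> z" "0 \<le> z'" "inf z z' = 0"
  shows "inf g h = 0"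
proof (rule dual_inf_eq_0I)
  show "0 \<le> g" "0 \<le> h" using g h by (auto simp: carried_by_def)
  fix w :: 'a and \<epsilon> :: real assume w: "0 \<le> w" and "0 < \<epsilon>"
  then obtain k where k: "0 \<le> k" "dual_apply g (pprt (w - k *\<^sub>R z)) \<le> \<epsilon>"
    using g unfolding carried_by_def by blast
  have kz: "0 \<le> k *\<^sub>R z" using k z by (simp add: scaleR_nonneg_nonneg)
  have "inf z' z = 0" using z(3) by (simp only: inf_commute)
  then have "inf z' (k *\<^sub>R z) = 0" using z k by (intro inf_scaleR_eq_0)
  then have "inf (k *\<^sub>R z) z' = 0" by (simp only: inf_commute)
  then have "inf (inf w (k *\<^sub>R z)) z' = 0"
    by (rule inf_eq_0_mono) (use w kz z(2) in simp_all)
  then have "dual_apply h (inf w (k *\<^sub>R z)) = 0"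
    using w kz by (intro carried_by_disjoint_vector[OF h z(2)]) auto
  moreover have "w - pprt (w - k *\<^sub>R z) = inf w (k *\<^sub>R z)"
    by (simp only: pprt_diff_eq_diff_inf diff_diff_eq2 add_diff_cancel_left')
  moreover have "pprt (w - k *\<^sub>R z) \<le> w" using w kz by (simp add: pprt_def)
  ultimately show "\<exists>y. 0 \<le> y \<and> y \<le> w \<and> dual_apply g y + dual_apply h (w - y) \<le> \<epsilon>"
    using k(2) by (intro exI[of _ "pprt (w - k *\<^sub>R z)"]) (simp del: dual_apply_right_simps)
qed

lemma exists_norming_functional:
  fixes z :: "'a::banach_lattice"
  assumes "0 \<le> z"
  shows "\<exists>f. 0 \<le> f \<and> norm f \<le> 1 \<and> dual_apply f z = norm z"
proof -
  have "sublinear (\<lambda>x::'a. norm (pprt x))"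
    unfolding sublinear_def
  proof (intro conjI allI impI)
    fix x y :: 'a
    have "norm (pprt (x + y)) \<le> norm (pprt x + pprt y)"
      by (intro banach_lattice_norm_mono pprt_add_le) simp
    also have "\<dots> \<le> norm (pprt x) + norm (pprt y)" by (rule norm_triangle_ineq)
    finally show "norm (pprt (x + y)) \<le> norm (pprt x) + norm (pprt y)" .
  qed (simp add: pprt_scaleR)
  then show ?thesis using Hahn_Banach_positive[of norm 1 z] assms by auto
qed

text \<open>
  A norming functional \<open>f\<close> of \<open>z\<close> is replaced by its part on the band of \<open>z\<close>. That part,
  \<open>p x = sup\<^sub>t f (inf x (t z))\<close>, is visibly sublinear, so instead of proving its additivity
  one takes a functional below it that agrees with it at \<open>z\<close>. Membership below \<open>p\<close> already
  gives the carrying property, since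
  \<open>p ((y - k z)\<^sup>+) \<le> p y - f (inf y (k z))\<close> becomes small.
\<close>

lemma exists_carried_norming_functional:
  fixes z :: "'a::banach_lattice"
  assumes z: "0 \<le> z"
  shows "\<exists>g. carried_by g z \<and> norm g \<le> 1 \<and> dual_apply g z = norm z"
proof -
  obtain f where f: "0 \<le> f" "norm f \<le> 1" "dual_apply f z = norm z"
    using exists_norming_functional[OF z] by blast
  define p where "p = (\<lambda>x. SUP t\<in>{0..}. dual_apply f (inf x (t *\<^sub>R z)))"
  have up: "dual_apply f (inf x (t *\<^sub>R z)) \<le> p x" if "0 \<le> t" for x t
    unfolding p_def using that f(1)
    by (intro cSUP_upper bdd_aboveI2[where M = "dual_apply f x"] dual_apply_mono) auto
  have least: "p x \<le> b" if "\<And>t. 0 \<le> t \<Longrightarrow> dual_apply f (inf x (t *\<^sub>R z)) \<le> b" for x b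
    unfolding p_def using that by (intro cSUP_least) auto
  have tz: "0 \<le> t *\<^sub>R z" if "0 \<le> t" for t using that z by (simp add: scaleR_nonneg_nonneg)
  have "sublinear (\<lambda>x. p (pprt x))"
    unfolding sublinear_def
  proof (intro conjI allI impI)
    fix x y
    show "p (pprt (x + y)) \<le> p (pprt x) + p (pprt y)"
    proof (rule least)
      fix t :: real assume t: "0 \<le> t"
      have "inf (pprt (x + y)) (t *\<^sub>R z) \<le> inf (t *\<^sub>R z) (pprt x + pprt y)"
        using pprt_add_le[of x y] by (simp add: le_infI1)
      also have "\<dots> \<le> inf (t *\<^sub>R z) (pprt x) + inf (t *\<^sub>R z) (pprt y)"
        using tz[OF t] by (intro inf_add_le) auto
      finally have "dual_apply f (inf (pprt (x + y)) (t *\<^sub>R z))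
          \<le> dual_apply f (inf (pprt x) (t *\<^sub>R z) + inf (pprt y) (t *\<^sub>R z))"
        by (intro dual_apply_mono f) (simp add: inf_commute)
      also have "\<dots> \<le> p (pprt x) + p (pprt y)" using up[OF t] by (simp add: add_mono)
      finally show "dual_apply f (inf (pprt (x + y)) (t *\<^sub>R z)) \<le> p (pprt x) + p (pprt y)" .
    qed
  next
    fix c :: real and x assume c: "0 < c"
    show "p (pprt (c *\<^sub>R x)) \<le> c * p (pprt x)"
    proof (rule least)
      fix t :: real assume t: "0 \<le> t"
      have "inf (pprt (c *\<^sub>R x)) (t *\<^sub>R z) = c *\<^sub>R inf (pprt x) ((t / c) *\<^sub>R z)"
        using c by (simp add: scaleR_inf pprt_scaleR)
      then show "dual_apply f (inf (pprt (c *\<^sub>R x)) (t *\<^sub>R z)) \<le> c * p (pprt x)"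
        using up[of "t / c" "pprt x"] t c by simp
    qed
  qed
  moreover have "p x \<le> 1 * norm x" if "0 \<le> x" for x
  proof (rule least)
    fix t :: real
    have "dual_apply f (inf x (t *\<^sub>R z)) \<le> dual_apply f x" by (intro dual_apply_mono f) simp
    also have "\<dots> \<le> norm f * norm x" using abs_dual_apply_le[of f x] by linarith
    also have "\<dots> \<le> 1 * norm x" using f(2) by (intro mult_right_mono) auto
    finally show "dual_apply f (inf x (t *\<^sub>R z)) \<le> 1 * norm x" .
  qed
  ultimately obtain g where g: "0 \<le> g" "norm g \<le> 1" "dual_apply g z = p z"
    and gp: "\<And>x. 0 \<le> x \<Longrightarrow> dual_apply g x \<le> p x"
    using Hahn_Banach_positive[of p 1 z] z by auto
  have "p z \<le> norm z"
    by (rule least) (metis dual_apply_mono f(1,3) inf.cobounded1)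
  moreover have "norm z \<le> p z" using up[of 1 z] f(3) by simp
  ultimately have "dual_apply g z = norm z" using g(3) by simp
  moreover have "carried_by g z"
    unfolding carried_by_def
  proof (intro conjI allI impI g(1))
    fix y :: 'a and \<epsilon> :: real assume y: "0 \<le> y" and \<epsilon>: "0 < \<epsilon>"
    have "\<exists>k\<ge>0. p y - \<epsilon> < dual_apply f (inf y (k *\<^sub>R z))"
    proof (rule ccontr)
      assume "\<not> ?thesis"
      then have "p y \<le> p y - \<epsilon>" by (intro least) (simp add: not_less)
      with \<epsilon> show False by simp
    qed
    then obtain k where k: "0 \<le> k" "p y - \<epsilon> < dual_apply f (inf y (k *\<^sub>R z))" by blast
    have "p (pprt (y - k *\<^sub>R z)) \<le> \<epsilon>"
    proof (rule least)
      fix t :: real assume t: "0 \<le> t"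
      have "inf (pprt (y - k *\<^sub>R z)) (t *\<^sub>R z)
          = inf y (t *\<^sub>R z + inf y (k *\<^sub>R z)) - inf y (k *\<^sub>R z)"
        using add_inf_distrib_right[of "y - inf y (k *\<^sub>R z)" "t *\<^sub>R z" "inf y (k *\<^sub>R z)"]
        by (simp only: pprt_diff_eq_diff_inf eq_diff_eq diff_add_cancel)
      also have "\<dots> \<le> inf y ((t + k) *\<^sub>R z) - inf y (k *\<^sub>R z)"
      proof -
        have "t *\<^sub>R z + inf y (k *\<^sub>R z) \<le> (t + k) *\<^sub>R z" by (simp add: scaleR_add_left)
        then show ?thesis by (intro diff_right_mono inf_mono) simp_all
      qed
      finally have "dual_apply f (inf (pprt (y - k *\<^sub>R z)) (t *\<^sub>R z))
          \<le> dual_apply f (inf y ((t + k) *\<^sub>R z) - inf y (k *\<^sub>R z))"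
        by (intro dual_apply_mono f)
      also have "\<dots> = dual_apply f (inf y ((t + k) *\<^sub>R z)) - dual_apply f (inf y (k *\<^sub>R z))"
        by (rule dual_apply_right_simps)
      also have "\<dots> \<le> \<epsilon>" using up[of "t + k" y] t k by simp
      finally show "dual_apply f (inf (pprt (y - k *\<^sub>R z)) (t *\<^sub>R z)) \<le> \<epsilon>" .
    qed
    then show "\<exists>k\<ge>0. dual_apply g (pprt (y - k *\<^sub>R z)) \<le> \<epsilon>"
      using k(1) gp[of "pprt (y - k *\<^sub>R z)"] by (intro exI[of _ k]) auto
  qed
  ultimately show ?thesis using g(2) by blast
qed

text \<open>
  Norming functionals \<open>g n\<close> carried by \<open>p n\<close> form a bounded disjoint sequence. They vanish on
  the negative part of \<open>x\<close>, so \<open>norm (p n) = g n (p n) \<le> g n x\<close>.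
\<close>

lemma disjoint_below_pprt_null:
  fixes x :: "'a::banach_lattice"
  assumes dual: "\<And>x'. bounded (range x') \<Longrightarrow> disjoint_net (UNIV :: nat set) x' \<Longrightarrow>
      (\<lambda>n. dual_apply (x' n) x) \<longlonglongrightarrow> 0"
    and p0: "\<And>n. 0 \<le> p n" and px: "\<And>n. p n \<le> pprt x" and p: "disjoint_net (UNIV :: nat set) p"
  shows "p \<longlonglongrightarrow> 0"
proof -
  obtain g where g: "\<And>n. carried_by (g n) (p n)" "\<And>n. norm (g n) \<le> 1"
      "\<And>n. dual_apply (g n) (p n) = norm (p n)"
    using exists_carried_norming_functional[OF p0] by metis
  have g0: "0 \<le> g n" for n using g(1) by (simp add: carried_by_def)
  have "disjoint_net UNIV g"
    unfolding disjoint_net_def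
  proof (intro ballI impI)
    fix m n :: nat assume "m \<noteq> n"
    then have "inf (p m) (p n) = 0" using p p0 by (simp add: disjoint_net_def)
    then have "inf (g m) (g n) = 0" by (rule carried_by_disjoint[OF g(1) g(1) p0 p0])
    then show "inf \<bar>g m\<bar> \<bar>g n\<bar> = 0" using g0 by simp
  qed
  moreover have "bounded (range g)" using g(2) by (auto simp: bounded_iff)
  ultimately have lim: "(\<lambda>n. dual_apply (g n) x) \<longlonglongrightarrow> 0" by (intro dual)
  have "norm (p n) \<le> dual_apply (g n) x" for n
  proof -
    have "inf (pprt x) (- nprt x) = 0"
      using inf_pprt_eq_0[of x 0] by (simp only: diff_0_right diff_0 pprt_neg)
    then have "inf (p n) (- nprt x) = 0"
      by (rule inf_eq_0_mono[OF _ p0 px]) simp_all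
    then have "dual_apply (g n) (- nprt x) = 0"
      by (intro carried_by_disjoint_vector[OF g(1) p0]) (simp_all only: inf_commute neg_0_le_iff_le nprt_le_zero)
    moreover have "norm (p n) \<le> dual_apply (g n) (pprt x)"
      using dual_apply_mono[OF g0 px, of n n] g(3) by simp
    moreover have "dual_apply (g n) x = dual_apply (g n) (pprt x) + dual_apply (g n) (nprt x)"
      using arg_cong[OF prts[of x], of "dual_apply (g n)"] by simp
    ultimately show ?thesis by simp
  qed
  then have "\<forall>\<^sub>F n in sequentially. norm (p n) \<le> dual_apply (g n) x" by (rule always_eventually[OF allI])
  then show ?thesis using lim by (rule Lim_null_comparison)
qed

text \<open>
  A vector below \<open>\<bar>x\<bar>\<close> is dominated by the sum of its infima with \<open>x\<^sup>+\<close> and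
  \<open>(- x)\<^sup>+\<close>, and the hypothesis on \<open>x\<close> is invariant under \<open>x \<mapsto> - x\<close>.
\<close>

lemma disjoint_interval_null_of_dual:
  fixes x :: "'a::banach_lattice"
  assumes dual: "\<And>x'. bounded (range x') \<Longrightarrow> disjoint_net (UNIV :: nat set) x' \<Longrightarrow>
      (\<lambda>n. dual_apply (x' n) x) \<longlonglongrightarrow> 0"
    and z: "range z \<subseteq> {0..\<bar>x\<bar>}" "disjoint_net (UNIV :: nat set) z"
  shows "z \<longlonglongrightarrow> 0"
proof -
  have "z n \<in> {0..\<bar>x\<bar>}" for n using z(1) by blast
  then have z0: "0 \<le> z n" and zx: "z n \<le> \<bar>x\<bar>" for n by auto
  have disj: "disjoint_net UNIV (\<lambda>n. inf (z n) a)" if "0 \<le> a" for a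
    unfolding disjoint_net_def
  proof (intro ballI impI)
    fix m n :: nat assume "m \<noteq> n"
    then have "inf (z m) (z n) = 0" using z(2) z0 by (simp add: disjoint_net_def)
    then have "inf (inf (z m) a) (inf (z n) a) = 0"
      by (rule inf_eq_0_mono) (use that z0 in simp_all)
    then show "inf \<bar>inf (z m) a\<bar> \<bar>inf (z n) a\<bar> = 0"
      using that z0 by (simp only: abs_of_nonneg le_inf_iff)
  qed
  have 1: "(\<lambda>n. inf (z n) (pprt x)) \<longlonglongrightarrow> 0"
    by (rule disjoint_below_pprt_null[OF dual]) (use z0 disj in auto)
  have 2: "(\<lambda>n. inf (z n) (pprt (- x))) \<longlonglongrightarrow> 0"
  proof (rule disjoint_below_pprt_null)
    fix x' :: "nat \<Rightarrow> 'a dual"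
    assume "bounded (range x')" "disjoint_net (UNIV :: nat set) x'"
    then show "(\<lambda>n. dual_apply (x' n) (- x)) \<longlonglongrightarrow> 0" using tendsto_minus[OF dual] by fastforce
  qed (use z0 disj in auto)
  have "norm (z n) \<le> norm (inf (z n) (pprt x) + inf (z n) (pprt (- x)))" for n
  proof (rule banach_lattice_norm_mono[OF z0])
    have "z n = inf (z n) (pprt x + pprt (- x))"
      using zx[of n] by (simp add: inf_absorb1 abs_prts pprt_neg)
    also have "\<dots> \<le> inf (z n) (pprt x) + inf (z n) (pprt (- x))"
      using z0 by (intro inf_add_le) auto
    finally show "z n \<le> inf (z n) (pprt x) + inf (z n) (pprt (- x))" .
  qed
  moreover have "(\<lambda>n. norm (inf (z n) (pprt x) + inf (z n) (pprt (- x)))) \<longlonglongrightarrow> 0"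
    using tendsto_add[OF 1 2] by (simp add: tendsto_norm_zero)
  ultimately show ?thesis by (rule Lim_null_comparison[OF always_eventually[OF allI]])
qed

section \<open>Increasing sequences in an interval\<close>

definition disjoint_sequences_null :: "'a::banach_lattice \<Rightarrow> bool"
  where "disjoint_sequences_null w \<longleftrightarrow>
    (\<forall>z. range z \<subseteq> {0..w} \<and> disjoint_net (UNIV :: nat set) z \<longrightarrow> z \<longlonglongrightarrow> 0)"

text \<open>
  For functions: where \<open>q - p\<close> exceeds one grid step \<open>w / K\<close>, the interval between \<open>p\<close> and \<open>q\<close>
  contains grid levels \<open>c\<^sub>j = (j / K) w\<close>. The summand for \<open>c\<^sub>j\<close> is supported where \<open>p < c\<^sub>j < q\<close>
  and the summands together make up for the rest of \<open>q - p\<close>. The proof slices \<open>q\<close> and \<open>p\<close>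
  between consecutive levels and compares the slice of \<open>q\<close> above a level with the slice of \<open>p\<close>
  below the same level; this shift by one slice costs the term \<open>w / K\<close>.
\<close>

lemma diff_le_level_crossings:
  fixes p q w :: "'a::banach_lattice"
  assumes "0 \<le> p" "p \<le> q" "q \<le> w" and K: "0 < K"
  defines "c \<equiv> \<lambda>j. (real j / real K) *\<^sub>R w"
  shows "q - p \<le> (1 / real K) *\<^sub>R w
    + (\<Sum>j<K. inf (pprt (q - c (Suc j))) (pprt (c (Suc j) - p)))"
proof -
  have w: "0 \<le> w" using assms by order
  define h where "h = (1 / real K) *\<^sub>R w"
  have c_Suc: "c (Suc j) = c j + h" for j
    by (simp add: c_def h_def add_divide_distrib flip: scaleR_add_left)
  have h: "0 \<le> h" using w by (simp add: h_def scaleR_nonneg_nonneg)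
  have c0: "c 0 = 0" and cK: "c K = w" using K by (simp_all add: c_def)
  define a where "a = (\<lambda>j. inf q (c j))"
  define b where "b = (\<lambda>j. inf p (c j))"
  have mono: "b j \<le> b (Suc j)" for j using h by (auto simp: b_def c_Suc intro: le_infI2)
  have step: "a (Suc j) \<le> a j + h" for j
  proof -
    have "a j + h = inf (q + h) (c (Suc j))" by (simp only: a_def add_inf_distrib_right c_Suc)
    then show ?thesis using h by (simp add: a_def le_infI1)
  qed
  have slice: "(a (Suc (Suc j)) - a (Suc j)) - (b (Suc j) - b j)
      \<le> inf (pprt (q - c (Suc j))) (pprt (c (Suc j) - p))" for j
  proof (rule le_infI)
    have "(a (Suc (Suc j)) - a (Suc j)) - (b (Suc j) - b j) \<le> a (Suc (Suc j)) - a (Suc j)"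
      using mono[of j] by simp
    also have "\<dots> \<le> q - a (Suc j)" by (intro diff_right_mono) (simp add: a_def)
    also have "\<dots> = pprt (q - c (Suc j))" by (simp only: a_def pprt_diff_eq_diff_inf)
    finally show "(a (Suc (Suc j)) - a (Suc j)) - (b (Suc j) - b j) \<le> pprt (q - c (Suc j))" .
    have "(a (Suc (Suc j)) - a (Suc j)) - (b (Suc j) - b j) \<le> h - (b (Suc j) - b j)"
      using step[of "Suc j"] by (intro diff_right_mono) (simp add: algebra_simps)
    also have "\<dots> = (b j + h) - b (Suc j)" by simp
    also have "\<dots> \<le> c (Suc j) - b (Suc j)"
      unfolding c_Suc by (intro diff_right_mono add_right_mono) (simp add: b_def)
    also have "\<dots> = pprt (c (Suc j) - p)"
      by (simp only: b_def pprt_diff_eq_diff_inf inf_commute)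
    finally show "(a (Suc (Suc j)) - a (Suc j)) - (b (Suc j) - b j) \<le> pprt (c (Suc j) - p)" .
  qed
  have "a (Suc K) = q"
    using assms(3) h by (simp add: a_def c_Suc cK inf_absorb1 add_increasing2)
  moreover have "a (Suc 0) \<le> h" by (simp add: a_def c_Suc c0 le_infI2)
  moreover have "b K = p" "b 0 = 0"
    using assms(1-3) by (simp_all add: b_def cK c0 inf_absorb1 inf_absorb2)
  moreover have "(\<Sum>j<K. (a (Suc (Suc j)) - a (Suc j)) - (b (Suc j) - b j))
      = (a (Suc K) - a (Suc 0)) - (b K - b 0)"
    by (simp only: sum_subtractf[where g = "\<lambda>j. b (Suc j) - b j"] sum_lessThan_telescope
        sum_lessThan_telescope[of "\<lambda>j. a (Suc j)"])
  ultimately have "(\<Sum>j<K. (a (Suc (Suc j)) - a (Suc j)) - (b (Suc j) - b j)) = (q - p) - a (Suc 0)"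
      and "a (Suc 0) \<le> h"
    by (simp_all add: algebra_simps)
  then have "q - p \<le> h + (\<Sum>j<K. (a (Suc (Suc j)) - a (Suc j)) - (b (Suc j) - b j))"
    by simp
  also have "\<dots> \<le> h + (\<Sum>j<K. inf (pprt (q - c (Suc j))) (pprt (c (Suc j) - p)))"
    by (intro add_left_mono sum_mono slice)
  finally show ?thesis by (simp only: h_def)
qed

text \<open>
  An increasing sequence crosses a given level at most once.
\<close>

lemma level_crossings_disjoint:
  fixes u :: "nat \<Rightarrow> 'a::banach_lattice"
  assumes "mono u"
  shows "disjoint_net UNIV (\<lambda>n. inf (pprt (u (Suc n) - c)) (pprt (c - u n)))"
    (is "disjoint_net UNIV ?d")
proof -
  have lt: "inf (?d m) (?d n) = 0" if "m < n" for m n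
  proof (rule inf_eq_0_mono)
    show "inf (pprt (u (Suc m) - c)) (pprt (c - u (Suc m))) = 0" by (rule inf_pprt_eq_0)
    have "u (Suc m) \<le> u n" using that by (intro monoD[OF assms]) simp
    then have "pprt (c - u n) \<le> pprt (c - u (Suc m))" by (intro pprt_mono diff_left_mono)
    then show "?d n \<le> pprt (c - u (Suc m))" by (rule le_infI2)
  qed simp_all
  have nonneg: "\<bar>?d n\<bar> = ?d n" for n by (intro abs_of_nonneg) simp
  show ?thesis
    unfolding disjoint_net_def
  proof (intro ballI impI)
    fix m n :: nat assume "m \<noteq> n"
    then show "inf \<bar>?d m\<bar> \<bar>?d n\<bar> = 0"
      unfolding nonneg using lt[of m n] lt[of n m] by (metis inf_commute linorder_neqE_nat)
  qed
qed

text \<open>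
  Up to the small multiple \<open>w / K\<close>, the increments are dominated by finitely many sequences of
  level crossings, and these are disjoint sequences in \<open>{0..w}\<close>.
\<close>

lemma increments_null:
  fixes u :: "nat \<Rightarrow> 'a::banach_lattice"
  assumes null: "disjoint_sequences_null w"
    and u: "mono u" "\<And>n. 0 \<le> u n" "\<And>n. u n \<le> w"
  shows "(\<lambda>n. u (Suc n) - u n) \<longlonglongrightarrow> 0"
  unfolding tendsto_iff
proof (intro allI impI)
  fix \<epsilon> :: real assume "0 < \<epsilon>"
  \<comment> \<open>a grid step of norm less than \<open>\<epsilon> / 2\<close>\<close>
  obtain K :: nat where K: "2 * norm w / \<epsilon> < real K" using reals_Archimedean2 by blast
  then have K0: "0 < K" using \<open>0 < \<epsilon>\<close> by (cases K) (auto simp: field_simps not_less)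
  define d where "d = (\<lambda>j n. inf (pprt (u (Suc n) - (real (Suc j) / real K) *\<^sub>R w))
    (pprt ((real (Suc j) / real K) *\<^sub>R w - u n)))"
  have w: "0 \<le> w" using u(2,3) order_trans by blast
  have "(\<lambda>n. d j n) \<longlonglongrightarrow> 0" for j
  proof (rule null[unfolded disjoint_sequences_null_def, rule_format], intro conjI)
    show "disjoint_net UNIV (d j)" unfolding d_def by (rule level_crossings_disjoint[OF u(1)])
    have "d j n \<le> w" for n
    proof -
      have "d j n \<le> pprt (u (Suc n) - (real (Suc j) / real K) *\<^sub>R w)" by (simp add: d_def)
      also have "\<dots> \<le> pprt (u (Suc n))"
        using w by (intro pprt_mono) (simp add: scaleR_nonneg_nonneg)
      also have "\<dots> \<le> w" using u(2,3) by simp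
      finally show ?thesis .
    qed
    then show "range (d j) \<subseteq> {0..w}" by (auto simp: d_def)
  qed
  then have "(\<lambda>n. \<Sum>j<K. d j n) \<longlonglongrightarrow> (\<Sum>j<K. 0)" by (intro tendsto_sum)
  then have "\<forall>\<^sub>F n in sequentially. norm (\<Sum>j<K. d j n) < \<epsilon> / 2"
    using tendstoD[of "\<lambda>n. \<Sum>j<K. d j n" 0 sequentially "\<epsilon> / 2"] \<open>0 < \<epsilon>\<close> by simp
  then show "\<forall>\<^sub>F n in sequentially. dist (u (Suc n) - u n) 0 < \<epsilon>"
  proof eventually_elim
    case (elim n)
    have un: "u n \<le> u (Suc n)" using u(1) by (simp add: mono_iff_le_Suc)
    have "norm (u (Suc n) - u n) \<le> norm ((1 / real K) *\<^sub>R w + (\<Sum>j<K. d j n))"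
    proof (rule banach_lattice_norm_mono)
      show "0 \<le> u (Suc n) - u n" using un by simp
      show "u (Suc n) - u n \<le> (1 / real K) *\<^sub>R w + (\<Sum>j<K. d j n)"
        unfolding d_def using diff_le_level_crossings[OF u(2) un u(3) K0] .
    qed
    also have "\<dots> \<le> norm ((1 / real K) *\<^sub>R w) + norm (\<Sum>j<K. d j n)" by (rule norm_triangle_ineq)
    also have "\<dots> < \<epsilon> / 2 + \<epsilon> / 2"
      using K K0 \<open>0 < \<epsilon>\<close> elim by (intro add_strict_mono) (simp_all add: field_simps)
    finally show ?case using elim by (simp add: dist_norm)
  qed
qed

text \<open>
  An increasing sequence that is not Cauchy has a subsequence, again increasing, whose increments
  stay away from zero.
\<close>

lemma increasing_convergent:
  fixes u :: "nat \<Rightarrow> 'a::banach_lattice"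
  assumes null: "disjoint_sequences_null w"
    and u: "mono u" "\<And>n. 0 \<le> u n" "\<And>n. u n \<le> w"
  shows "convergent u"
proof (rule ccontr)
  assume "\<not> convergent u"
  then have "\<not> Cauchy u" by (simp add: Cauchy_convergent_iff)
  then obtain \<epsilon> where \<epsilon>: "0 < \<epsilon>" and far: "\<And>m. \<exists>n>m. \<epsilon> \<le> norm (u n - u m)"
    unfolding Cauchy_altdef2 dist_norm not_all not_ex
    by (metis diff_self norm_zero not_less order_le_less linorder_not_le)
  obtain r where r: "\<And>n. r n < r (Suc n)" "\<And>n. \<epsilon> \<le> norm (u (r (Suc n)) - u (r n))"
  proof -
    have "\<exists>r. \<forall>n. True \<and> (r n < r (Suc n) \<and> \<epsilon> \<le> norm (u (r (Suc n)) - u (r n)))"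
      by (rule dependent_nat_choice) (use far in auto)
    then show thesis using that by blast
  qed
  have "mono (u \<circ> r)"
    unfolding mono_iff_le_Suc comp_def
    by (intro allI monoD[OF u(1)] order_less_imp_le r(1))
  then have "(\<lambda>n. (u \<circ> r) (Suc n) - (u \<circ> r) n) \<longlonglongrightarrow> 0"
    by (rule increments_null[OF null]) (use u(2,3) in auto)
  from tendstoD[OF this \<epsilon>] obtain n where "norm (u (r (Suc n)) - u (r n)) < \<epsilon>"
    by (auto simp: eventually_sequentially)
  with r(2)[of n] show False by simp
qed

section \<open>Uniform truncation of bounded sets of functionals\<close>

text \<open>
  \<open>Y n\<close> is the supremum of all \<open>y m\<close> with \<open>m \<ge> n\<close>, obtained as the norm limit of finite
  suprema. The last clause, countable subadditivity, is phrased with partial sums.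
\<close>

lemma tail_suprema:
  fixes y :: "nat \<Rightarrow> 'a::banach_lattice"
  assumes null: "disjoint_sequences_null w"
    and y: "\<And>n. 0 \<le> y n" "\<And>n. y n \<le> w"
  shows "\<exists>Y. (\<lambda>n. Y n - Y (Suc n)) \<longlonglongrightarrow> 0 \<and> (\<forall>n. y n \<le> Y n) \<and>
    (\<forall>f n b. 0 \<le> f \<and> (\<forall>N. (\<Sum>m=n..n+N. dual_apply f (y m)) \<le> b) \<longrightarrow> dual_apply f (Y n) \<le> b)"
proof -
  define s where "s = (\<lambda>n N. Sup_fin (y ` {n..n+N}))"
  have ys: "y m \<le> s n N" if "n \<le> m" "m \<le> n + N" for n m N
    unfolding s_def using that by (intro Sup_fin.coboundedI) auto
  have sle: "s n N \<le> b" if "\<And>m. n \<le> m \<Longrightarrow> m \<le> n + N \<Longrightarrow> y m \<le> b" for n N b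
    unfolding s_def using that by (intro Sup_fin.boundedI) auto
  have s0: "0 \<le> s n N" for n N using y(1)[of n] ys[of n n N] by (simp add: order_trans)
  have "convergent (s n)" for n
  proof (rule increasing_convergent[OF null])
    show "mono (s n)" by (intro monoI sle ys) auto
    show "s n N \<le> w" for N by (intro sle y)
  qed (rule s0)
  then obtain Y where Y: "\<And>n. s n \<longlonglongrightarrow> Y n" unfolding convergent_def by metis
  have yY: "y n \<le> Y n" for n
    by (rule Lim_le_Lim[OF tendsto_const Y]) (simp add: ys)
  have Y0: "0 \<le> Y n" for n using y(1)[of n] yY[of n] by (rule order_trans)
  have Yw: "Y n \<le> w" for n
    by (rule Lim_le_Lim[OF Y tendsto_const]) (simp add: sle y(2))
  have dec: "Y (Suc n) \<le> Y n" for n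
  proof (rule Lim_le_Lim[OF Y])
    show "(\<lambda>N. s n (Suc N)) \<longlonglongrightarrow> Y n" using Y by (rule LIMSEQ_Suc)
    have "s (Suc n) N \<le> s n (Suc N)" for N by (intro sle ys) auto
    then show "\<forall>\<^sub>F N in sequentially. s (Suc n) N \<le> s n (Suc N)" by (rule always_eventually[OF allI])
  qed
  have "mono (\<lambda>n. w - Y n)" unfolding mono_iff_le_Suc using dec by simp
  then have "(\<lambda>n. (w - Y (Suc n)) - (w - Y n)) \<longlonglongrightarrow> 0"
    by (rule increments_null[OF null]) (use Y0 Yw in auto)
  then have "(\<lambda>n. Y n - Y (Suc n)) \<longlonglongrightarrow> 0" by simp
  moreover have "dual_apply f (Y n) \<le> b"
    if f: "0 \<le> f" and b: "\<And>N. (\<Sum>m=n..n+N. dual_apply f (y m)) \<le> b" for f n b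
  proof (rule LIMSEQ_le_const2)
    show "(\<lambda>N. dual_apply f (s n N)) \<longlonglongrightarrow> dual_apply f (Y n)"
      by (intro bounded_linear.tendsto[OF bounded_linear_dual_apply] Y)
    have "dual_apply f (s n N) \<le> b" for N
    proof -
      have "s n N \<le> sum y {n..n+N}"
      proof (rule sle)
        fix m assume "n \<le> m" "m \<le> n + N"
        then have "sum y {m} \<le> sum y {n..n+N}" using y(1) by (intro sum_mono2) auto
        then show "y m \<le> sum y {n..n+N}" by simp
      qed
      then have "dual_apply f (s n N) \<le> dual_apply f (sum y {n..n+N})"
        by (intro dual_apply_mono f)
      also have "\<dots> = (\<Sum>m=n..n+N. dual_apply f (y m))"
        by (intro linear_sum bounded_linear.linear bounded_linear_dual_apply)
      also have "\<dots> \<le> b" by (rule b)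
      finally show ?thesis .
    qed
    then show "\<exists>N0. \<forall>N\<ge>N0. dual_apply f (s n N) \<le> b" by blast
  qed
  ultimately show ?thesis using yY by blast
qed

text \<open>
  Otherwise functionals \<open>f n\<close> and points \<open>y n\<close> of \<open>{0..w}\<close> can be chosen recursively such that
  \<open>f n (y n) > \<epsilon>\<close>, while \<open>f i (y n)\<close> is at most \<open>\<epsilon> / 2 * (1/2) ^ n\<close> for all
  \<open>i < n\<close>: apply the failure of the claim to a huge multiple of \<open>f 0 + \<dots> + f (n - 1)\<close>.
  With the tail suprema \<open>Y n\<close> of the points this gives \<open>f n (Y n) > \<epsilon>\<close> and
  \<open>f n (Y (n + 1)) \<le> \<epsilon> / 2\<close>, although \<open>Y n - Y (n + 1)\<close> tends to zero in norm
  and the \<open>f n\<close> are bounded.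
\<close>

lemma uniform_truncation:
  fixes w :: "'a::banach_lattice"
  assumes null: "disjoint_sequences_null w"
    and w: "0 \<le> w" and M: "0 \<le> M" and \<epsilon>: "0 < \<epsilon>"
  shows "\<exists>u\<ge>0. \<forall>f. 0 \<le> f \<and> norm f \<le> M \<longrightarrow> dual_apply (pprt (f - u)) w \<le> \<epsilon>"
proof (rule ccontr)
  assume neg: "\<not> ?thesis"
  have "\<exists>f y. 0 \<le> f \<and> norm f \<le> M \<and> 0 \<le> y \<and> y \<le> w \<and> dual_apply u y + \<epsilon> < dual_apply f y"
    if "0 \<le> u" for u
    using neg that dual_pprt_diff_gt[OF w] by (metis not_le)
  then obtain F V where FV: "\<And>u. 0 \<le> u \<Longrightarrow> 0 \<le> F u \<and> norm (F u) \<le> M \<and> 0 \<le> V u \<and> V u \<le> w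
      \<and> dual_apply u (V u) + \<epsilon> < dual_apply (F u) (V u)" by metis
  \<comment> \<open>\<open>D\<close> makes \<open>M * norm w / D\<close> at most \<open>\<epsilon> / 2\<close>; adding \<open>1\<close> keeps it positive\<close>
  define D where "D = 2 * (M * norm w + 1) / \<epsilon>"
  have D: "0 < D" using M \<epsilon> by (simp add: D_def add_nonneg_pos)
  \<comment> \<open>the running sums of the chosen functionals drive the recursion\<close>
  define S where "S = rec_nat (0 :: 'a dual) (\<lambda>n s. s + F ((2 ^ n * D) *\<^sub>R s))"
  define f where "f = (\<lambda>n. F ((2 ^ n * D) *\<^sub>R S n))"
  define y where "y = (\<lambda>n. V ((2 ^ n * D) *\<^sub>R S n))"
  have S_Suc: "S (Suc n) = S n + f n" for n by (simp add: S_def f_def)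
  have S0: "0 \<le> S n" for n
  proof (induction n)
    case (Suc n)
    then have "0 \<le> f n" using FV D unfolding f_def by (simp add: scaleR_nonneg_nonneg)
    with Suc show ?case by (simp add: S_Suc)
  qed (simp add: S_def)
  have arg0: "0 \<le> (2 ^ n * D) *\<^sub>R S n" for n using S0 D by (simp add: scaleR_nonneg_nonneg)
  have f0: "0 \<le> f n" and fM: "norm (f n) \<le> M" and y0: "0 \<le> y n" and yw: "y n \<le> w"
    and big: "(2 ^ n * D) * dual_apply (S n) (y n) + \<epsilon> < dual_apply (f n) (y n)" for n
    using FV[OF arg0[of n]] by (simp_all add: f_def y_def)
  have fw: "dual_apply (f n) z \<le> M * norm z" for n z
  proof -
    have "dual_apply (f n) z \<le> norm (f n) * norm z" using abs_dual_apply_le[of "f n" z] by linarith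
    also have "\<dots> \<le> M * norm z" using fM by (intro mult_right_mono) auto
    finally show ?thesis .
  qed
  have Sle: "f i \<le> S n" if "i < n" for i n
    using that
  proof (induction n)
    case (Suc n)
    show ?case
    proof (cases "i = n")
      case False
      then have "f i \<le> S n" using Suc by simp
      then show ?thesis using f0[of n] by (simp add: S_Suc add_increasing2)
    qed (use S0[of n] in \<open>simp add: S_Suc\<close>)
  qed simp
  have small: "dual_apply (f i) (y n) \<le> \<epsilon> / 2 * (1/2) ^ n" if "i < n" for i n
  proof -
    have "dual_apply (f i) (y n) \<le> dual_apply (S n) (y n)"
      using Sle[OF that] y0 by (simp add: dual_le_iff)
    then have "(2 ^ n * D) * dual_apply (f i) (y n) \<le> (2 ^ n * D) * dual_apply (S n) (y n)"
      using D by (intro mult_left_mono) auto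
    also have "\<dots> \<le> dual_apply (f n) w"
      using big[of n] dual_apply_mono[OF f0 yw, of n n] \<epsilon> by linarith
    also have "\<dots> \<le> M * norm w" by (rule fw)
    also have "\<dots> \<le> D * (\<epsilon> / 2)" using \<epsilon> by (simp add: D_def)
    finally have "2 ^ n * dual_apply (f i) (y n) \<le> \<epsilon> / 2" using D by (simp add: mult.assoc mult.left_commute)
    then show ?thesis by (simp add: field_simps power_divide)
  qed
  obtain Y where Y: "(\<lambda>n. Y n - Y (Suc n)) \<longlonglongrightarrow> 0" "\<And>n. y n \<le> Y n"
    and Yle: "\<And>f n b. 0 \<le> f \<Longrightarrow> (\<And>N. (\<Sum>m=n..n+N. dual_apply f (y m)) \<le> b) \<Longrightarrow> dual_apply f (Y n) \<le> b"
    using tail_suprema[where w = w and y = y, OF null y0 yw] by metis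
  have gap: "\<epsilon> / 2 < M * norm (Y n - Y (Suc n))" for n
  proof -
    have "dual_apply (f n) (Y (Suc n)) \<le> \<epsilon> / 2"
    proof (rule Yle[OF f0])
      fix N
      have "(\<Sum>m=Suc n..Suc n+N. dual_apply (f n) (y m)) \<le> (\<Sum>m=Suc n..Suc n+N. \<epsilon> / 2 * (1/2) ^ m)"
        by (intro sum_mono small) auto
      also have "\<dots> \<le> \<epsilon> / 2 * (\<Sum>m=1..Suc n+N. (1/2) ^ m)"
        unfolding sum_distrib_left[symmetric] using \<epsilon> by (intro mult_left_mono sum_mono2) auto
      also have "(\<Sum>m=1..Suc n+N. (1/2::real) ^ m) \<le> 1"
      proof -
        have "(\<Sum>m=1..k. (1/2::real) ^ m) = 1 - (1/2) ^ k" for k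
          by (induction k) (auto simp: field_simps)
        then show ?thesis by simp
      qed
      finally show "(\<Sum>m=Suc n..Suc n+N. dual_apply (f n) (y m)) \<le> \<epsilon> / 2"
        using \<epsilon> by simp
    qed
    moreover have "\<epsilon> < dual_apply (f n) (Y n)"
    proof -
      have "0 \<le> (2 ^ n * D) * dual_apply (S n) (y n)"
        using D S0 y0 by (intro mult_nonneg_nonneg dual_apply_nonneg) auto
      then have "\<epsilon> < dual_apply (f n) (y n)" using big[of n] by linarith
      also have "\<dots> \<le> dual_apply (f n) (Y n)" by (intro dual_apply_mono f0 Y)
      finally show ?thesis .
    qed
    moreover have "dual_apply (f n) (Y n) - dual_apply (f n) (Y (Suc n)) \<le> M * norm (Y n - Y (Suc n))"
      using fw[of n "Y n - Y (Suc n)"] by simp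
    ultimately show ?thesis by linarith
  qed
  have "(\<lambda>n. M * norm (Y n - Y (Suc n))) \<longlonglongrightarrow> M * 0"
    by (intro tendsto_mult tendsto_const tendsto_norm_zero Y)
  then have "\<forall>\<^sub>F n in sequentially. M * norm (Y n - Y (Suc n)) < \<epsilon> / 2"
    using \<epsilon> by (intro order_tendstoD) auto
  then show False using gap by (auto simp: eventually_sequentially intro: less_asym)
qed

text \<open>
  Split \<open>\<bar>x' a\<bar> = (\<bar>x' a\<bar> - u)\<^sup>+ + inf \<bar>x' a\<bar> u\<close>, with \<open>u\<close>
  truncating the bounded net uniformly. The first summand is small at \<open>\<bar>x\<bar>\<close> for every
  \<open>a\<close>, the second one eventually.
\<close>

lemma eval_tendsto_0_of_uaws_null:
  fixes x :: "'e::banach_lattice" and x' :: "'i \<Rightarrow> 'e dual"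
  assumes null: "disjoint_sequences_null \<bar>x\<bar>"
    and bdd: "\<forall>\<^sub>F a in F. norm (x' a) \<le> M" and M: "0 \<le> M" and uaws: "uaws_null x' F"
  shows "((\<lambda>a. dual_apply (x' a) x) \<longlongrightarrow> 0) F"
  unfolding tendsto_iff
proof (intro allI impI)
  fix \<epsilon> :: real assume \<epsilon>: "0 < \<epsilon>"
  obtain u where u: "0 \<le> u"
    and trunc: "\<And>f. 0 \<le> f \<Longrightarrow> norm f \<le> M \<Longrightarrow> dual_apply (pprt (f - u)) \<bar>x\<bar> \<le> \<epsilon> / 2"
    using uniform_truncation[where w = "\<bar>x\<bar>" and M = M and \<epsilon> = "\<epsilon> / 2", OF null] M \<epsilon> by auto
  have "((\<lambda>a. dual_apply (inf \<bar>x' a\<bar> u) \<bar>x\<bar>) \<longlongrightarrow> 0) F" using uaws u by (simp add: uaws_null_def)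
  then have "\<forall>\<^sub>F a in F. dual_apply (inf \<bar>x' a\<bar> u) \<bar>x\<bar> < \<epsilon> / 2"
    using \<epsilon> by (intro order_tendstoD) auto
  with bdd show "\<forall>\<^sub>F a in F. dist (dual_apply (x' a) x) 0 < \<epsilon>"
  proof eventually_elim
    case (elim a)
    have "dual_apply \<bar>x' a\<bar> \<bar>x\<bar>
        = dual_apply (pprt (\<bar>x' a\<bar> - u)) \<bar>x\<bar> + dual_apply (inf \<bar>x' a\<bar> u) \<bar>x\<bar>"
      by (simp only: pprt_diff_eq_diff_inf dual_apply_simps diff_add_cancel)
    also have "\<dots> < \<epsilon> / 2 + \<epsilon> / 2"
      using trunc[of "\<bar>x' a\<bar>"] elim by (intro add_le_less_mono) (auto simp: banach_lattice_norm_abs)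
    finally show ?case using abs_dual_apply_le_abs[of "x' a" x] by simp
  qed
qed


section \<open>Nets and sequences\<close>

lemma eventually_tails_member:
  assumes "directed_set A r"
  shows "\<forall>\<^sub>F a in tails A r. a \<in> A"
  using assms by (auto simp: eventually_tails[OF assms] directed_set_def)

lemma eventually_tails_neq:
  assumes A: "directed_set A r" and nomax: "\<nexists>m. m \<in> A \<and> (\<forall>a\<in>A. r a m)" and k: "k \<in> A"
  shows "\<forall>\<^sub>F a in tails A r. a \<noteq> k"
proof -
  obtain a where "a \<in> A" "\<not> r a k" using nomax k by blast
  then show ?thesis unfolding eventually_tails[OF A] by blast
qed


text \<open>
  The order of the natural numbers is transported along an injection \<open>h\<close>, with left inverse
  \<open>\<iota>\<close>, into the index type. The resulting directed set has no greatest element, as the nets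
  that test disjointness require.
\<close>

lemma sequence_as_net:
  assumes "infinite (UNIV :: 'i set)"
  shows "\<exists>(A :: 'i set) r (h :: nat \<Rightarrow> 'i) \<iota>. directed_set A r \<and> (\<nexists>m. m \<in> A \<and> (\<forall>a\<in>A. r a m)) \<and>
    A = range h \<and> (\<forall>n. \<iota> (h n) = n) \<and> tails A r = filtermap h sequentially"
proof -
  obtain h :: "nat \<Rightarrow> 'i" where h: "inj h"
    using infinite_countable_subset[OF assms] by blast
  define r where "r = (\<lambda>a b. inv h a \<le> inv h b)"
  have inv: "inv h (h n) = n" for n using h by simp
  have A: "directed_set (range h) r"
    unfolding directed_set_def
  proof (intro conjI ballI)
    show "reflp_on (range h) r" by (auto simp: r_def intro: reflp_onI)
    show "transp_on (range h) r" by (auto simp: r_def intro: transp_onI)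
    fix a b assume "a \<in> range h" "b \<in> range h"
    then obtain m n where "a = h m" "b = h n" by blast
    then show "\<exists>c\<in>range h. r a c \<and> r b c"
      by (intro bexI[of _ "h (max m n)"]) (simp_all add: r_def inv)
  qed simp
  moreover have "\<nexists>m. m \<in> range h \<and> (\<forall>a\<in>range h. r a m)"
    by (auto simp: r_def inv) (meson Suc_n_not_le_n)
  moreover have "tails (range h) r = filtermap h sequentially"
    unfolding filter_eq_iff eventually_tails[OF A] eventually_filtermap eventually_sequentially
    by (simp add: r_def inv)
  ultimately show ?thesis using h inv by blast
qed

lemma uo_null_filtermap: "uo_null x (filtermap h F) \<longleftrightarrow> uo_null (x \<circ> h) F"
  by (simp add: uo_null_def order_tendsto_def eventually_filtermap)

lemma un_null_filtermap: "un_null x (filtermap h F) \<longleftrightarrow> un_null (x \<circ> h) F"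
  by (simp add: un_null_def filterlim_filtermap)

lemma uaw_null_filtermap: "uaw_null x (filtermap h F) \<longleftrightarrow> uaw_null (x \<circ> h) F"
  by (simp add: uaw_null_def filterlim_filtermap)

lemma uaws_null_filtermap: "uaws_null x (filtermap h F) \<longleftrightarrow> uaws_null (x \<circ> h) F"
  by (simp add: uaws_null_def filterlim_filtermap)

lemma disjoint_net_relabel:
  assumes "disjoint_net UNIV x" "\<And>n. \<iota> (h n) = n"
  shows "disjoint_net (range h) (x \<circ> \<iota>)"
  unfolding disjoint_net_def
proof (intro ballI impI)
  fix a b assume "a \<in> range h" "b \<in> range h" "a \<noteq> b"
  then obtain m n where "a = h m" "b = h n" "m \<noteq> n" by blast
  then show "inf \<bar>(x \<circ> \<iota>) a\<bar> \<bar>(x \<circ> \<iota>) b\<bar> = 0" using assms by (simp add: disjoint_net_def)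
qed

text \<open>
  The predicate \<open>N\<close> stands for any of the notions of null net, and for disjointness; the latter
  is the reason why it may depend on the index set.
\<close>

lemma sequences_as_nets:
  fixes x :: "nat \<Rightarrow> 'x::banach_lattice" and f :: "'x \<Rightarrow> real"
    and N :: "('i \<Rightarrow> 'x) \<Rightarrow> 'i set \<Rightarrow> 'i filter \<Rightarrow> bool"
  assumes inf: "infinite (UNIV :: 'i set)" and bdd: "bounded (range x)"
    and nets: "\<And>A r x. directed_set A r \<Longrightarrow> \<nexists>m. m \<in> A \<and> (\<forall>a\<in>A. r a m) \<Longrightarrow> bounded (x ` A) \<Longrightarrow>
      N x A (tails A r) \<Longrightarrow> ((\<lambda>a. f (x a)) \<longlongrightarrow> 0) (tails A r)"
    and relabel: "\<And>h \<iota>. (\<And>n. \<iota> (h n) = n) \<Longrightarrow> N (x \<circ> \<iota>) (range h) (filtermap h sequentially)"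
  shows "(\<lambda>n. f (x n)) \<longlonglongrightarrow> 0"
proof -
  obtain A r and h :: "nat \<Rightarrow> 'i" and \<iota> where A: "directed_set A r" "\<nexists>m. m \<in> A \<and> (\<forall>a\<in>A. r a m)"
      "A = range h" "\<And>n. \<iota> (h n) = n" "tails A r = filtermap h sequentially"
    using sequence_as_net[OF inf] by metis
  have "(x \<circ> \<iota>) ` A = range x" using A(4) by (simp add: A(3) image_image)
  then have "bounded ((x \<circ> \<iota>) ` A)" using bdd by simp
  moreover have "N (x \<circ> \<iota>) A (tails A r)"
    unfolding A(5) unfolding A(3) by (rule relabel[OF A(4)])
  ultimately have "((\<lambda>a. f ((x \<circ> \<iota>) a)) \<longlongrightarrow> 0) (tails A r)"
    by (rule nets[OF A(1,2)])
  then show ?thesis by (simp add: A(4,5) filterlim_filtermap)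
qed

section \<open>The equivalences\<close>

lemma eval_tendsto_0_along_net:
  assumes "disjoint_sequences_null \<bar>x\<bar>" "directed_set A r" "bounded (x' ` A)"
    "uaws_null x' (tails A r)"
  shows "((\<lambda>a. eval_functional x (x' a)) \<longlongrightarrow> 0) (tails A r)"
proof -
  obtain M where M: "0 < M" "\<And>a. a \<in> A \<Longrightarrow> norm (x' a) \<le> M"
    using assms(3) by (auto simp: bounded_pos)
  have "\<forall>\<^sub>F a in tails A r. norm (x' a) \<le> M"
    using eventually_tails_member[OF assms(2)] by eventually_elim (rule M(2))
  then show ?thesis
    unfolding eval_functional_def
    using eval_tendsto_0_of_uaws_null[OF assms(1) _ _ assms(4), of M] M(1) by simp
qed

lemma all_equivalentI: "list_all (\<lambda>p. p = q) ps \<Longrightarrow> all_equivalent ps"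
  by (auto simp: all_equivalent_def list_all_iff)

theorem theorem2p6:
  fixes x :: "'e::banach_lattice"
  assumes index_type: "infinite (UNIV :: 'i set)"
  shows "all_equivalent [
      eval_functional x \<in> uaws_dual TYPE('i),
      \<forall>x'. bounded (range x') \<and> uaws_null x' sequentially \<longrightarrow> (\<lambda>n. eval_functional x (x' n)) \<longlonglongrightarrow> 0,
      eval_functional x \<in> uo_dual TYPE('i),
      \<forall>x'. bounded (range x') \<and> uo_null x' sequentially \<longrightarrow> (\<lambda>n. eval_functional x (x' n)) \<longlonglongrightarrow> 0,
      eval_functional x \<in> uaw_dual TYPE('i),
      \<forall>x'. bounded (range x') \<and> uaw_null x' sequentially \<longrightarrow> (\<lambda>n. eval_functional x (x' n)) \<longlonglongrightarrow> 0,
      eval_functional x \<in> d_dual TYPE('i),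
      \<forall>x'. bounded (range x') \<and> disjoint_net (UNIV :: nat set) x' \<longrightarrow> (\<lambda>n. eval_functional x (x' n)) \<longlonglongrightarrow> 0,
      \<forall>z. range z \<subseteq> {0..\<bar>x\<bar>} \<and> disjoint_net (UNIV :: nat set) z \<longrightarrow> z \<longlonglongrightarrow> 0]
    \<and> (order_continuous_norm TYPE('e dual) \<longrightarrow> all_equivalent [
      \<forall>z. range z \<subseteq> {0..\<bar>x\<bar>} \<and> disjoint_net (UNIV :: nat set) z \<longrightarrow> z \<longlonglongrightarrow> 0,
      eval_functional x \<in> un_dual TYPE('i),
      \<forall>x'. bounded (range x') \<and> un_null x' sequentially \<longrightarrow> (\<lambda>n. eval_functional x (x' n)) \<longlonglongrightarrow> 0])"
proof -
  let ?f = "eval_functional x"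
  let ?null9 = "\<forall>z. range z \<subseteq> {0..\<bar>x\<bar>} \<and> disjoint_net (UNIV :: nat set) z \<longrightarrow> z \<longlonglongrightarrow> 0"
  let ?seq = "\<lambda>C :: (nat \<Rightarrow> 'e dual) \<Rightarrow> bool.
    \<forall>x'. bounded (range x') \<and> C x' \<longrightarrow> (\<lambda>n. ?f (x' n)) \<longlonglongrightarrow> 0"
  have comp: "(x' \<circ> \<iota>) \<circ> h = x'" if "\<And>n. \<iota> (h n) = n"
    for x' :: "nat \<Rightarrow> 'e dual" and h :: "nat \<Rightarrow> 'i" and \<iota>
    using that by (simp add: fun_eq_iff)

  \<comment> \<open>the two substantial implications link the interval condition with the weakest and with the
    strongest of the other conditions\<close>
  have null9: ?null9 if "?seq (disjoint_net UNIV)"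
    using disjoint_interval_null_of_dual[of x] that unfolding eval_functional_def by blast
  have net: "((\<lambda>a. ?f (x' a)) \<longlongrightarrow> 0) (tails A r)"
    if ?null9 "directed_set A r" "bounded (x' ` A)" "uaws_null x' (tails A r)"
    for A :: "'i set" and r x'
    using that eval_tendsto_0_along_net[of x] unfolding disjoint_sequences_null_def by blast
  have nets: "?f \<in> uaws_dual TYPE('i)" "?f \<in> uo_dual TYPE('i)" "?f \<in> uaw_dual TYPE('i)"
      "?f \<in> un_dual TYPE('i)" if ?null9
    unfolding uaws_dual_def uo_dual_def uaw_dual_def un_dual_def
    using net[OF that] bounded_linear_eval[of x] bounded_linear.linear[OF bounded_linear_eval[of x]]
    by (auto intro: uo_null_imp_uaws_null uaw_null_imp_uaws_null
        uaw_null_imp_uaws_null[OF un_null_imp_uaw_null])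
  have d_net: "?f \<in> d_dual TYPE('i)" if ?null9
    unfolding d_dual_def
  proof (intro CollectI conjI allI impI bounded_linear_eval, elim conjE)
    fix A :: "'i set" and r and x' :: "'i \<Rightarrow> 'e dual"
    assume A: "directed_set A r" "\<nexists>m. m \<in> A \<and> (\<forall>a\<in>A. r a m)"
      and x': "bounded (x' ` A)" "disjoint_net A x'"
    have "uaw_null x' (tails A r)"
      by (rule disjoint_net_uaw_null[OF x'(2) eventually_tails_member eventually_tails_neq])
        (use A in auto)
    then show "((\<lambda>a. ?f (x' a)) \<longlongrightarrow> 0) (tails A r)"
      by (intro net[OF that A(1) x'(1)] uaw_null_imp_uaws_null)
  qed

  have uaws_seq: "?seq (\<lambda>x'. uaws_null x' sequentially)" if "?f \<in> uaws_dual TYPE('i)"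
    using sequences_as_nets[OF index_type, where f = ?f and N = "\<lambda>x' A F. uaws_null x' F"] that
    by (auto simp: uaws_dual_def uaws_null_filtermap comp)
  have uo_seq: "?seq (\<lambda>x'. uo_null x' sequentially)" if "?f \<in> uo_dual TYPE('i)"
    using sequences_as_nets[OF index_type, where f = ?f and N = "\<lambda>x' A F. uo_null x' F"] that
    by (auto simp: uo_dual_def uo_null_filtermap comp)
  have uaw_seq: "?seq (\<lambda>x'. uaw_null x' sequentially)" if "?f \<in> uaw_dual TYPE('i)"
    using sequences_as_nets[OF index_type, where f = ?f and N = "\<lambda>x' A F. uaw_null x' F"] that
    by (auto simp: uaw_dual_def uaw_null_filtermap comp)
  have un_seq: "?seq (\<lambda>x'. un_null x' sequentially)" if "?f \<in> un_dual TYPE('i)"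
    using sequences_as_nets[OF index_type, where f = ?f and N = "\<lambda>x' A F. un_null x' F"] that
    by (auto simp: un_dual_def un_null_filtermap comp)
  have d_seq: "?seq (disjoint_net UNIV)" if "?f \<in> d_dual TYPE('i)"
    using sequences_as_nets[OF index_type, where f = ?f and N = "\<lambda>x' A F. disjoint_net A x'"] that
    by (auto simp: d_dual_def disjoint_net_relabel)

  have neq: "\<forall>\<^sub>F n in sequentially. n \<noteq> k" for k :: nat
    using eventually_gt_at_top[of k] by eventually_elim simp
  have uo: "uo_null x' sequentially" and uaw: "uaw_null x' sequentially"
    if "disjoint_net UNIV x'" for x' :: "nat \<Rightarrow> 'e dual"
    using disjoint_net_uo_null[OF that _ neq] disjoint_net_uaw_null[OF that _ neq] by simp_all
  have uo_d: "?seq (disjoint_net UNIV)" if "?seq (\<lambda>x'. uo_null x' sequentially)"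
    using that uo by blast
  have uaw_d: "?seq (disjoint_net UNIV)" if "?seq (\<lambda>x'. uaw_null x' sequentially)"
    using that uaw by blast
  have uaws_d: "?seq (disjoint_net UNIV)" if "?seq (\<lambda>x'. uaws_null x' sequentially)"
    using that uaw uaw_null_imp_uaws_null by blast
  have un_uo: "?seq (\<lambda>x'. uo_null x' sequentially)"
    if "order_continuous_norm TYPE('e dual)" "?seq (\<lambda>x'. un_null x' sequentially)"
    using that order_continuous_uo_null_imp_un_null by blast

  have eqs:
    "?f \<in> uaws_dual TYPE('i) \<longleftrightarrow> ?null9" "?seq (\<lambda>x'. uaws_null x' sequentially) \<longleftrightarrow> ?null9"
    "?f \<in> uo_dual TYPE('i) \<longleftrightarrow> ?null9" "?seq (\<lambda>x'. uo_null x' sequentially) \<longleftrightarrow> ?null9"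
    "?f \<in> uaw_dual TYPE('i) \<longleftrightarrow> ?null9" "?seq (\<lambda>x'. uaw_null x' sequentially) \<longleftrightarrow> ?null9"
    "?f \<in> d_dual TYPE('i) \<longleftrightarrow> ?null9" "?seq (disjoint_net UNIV) \<longleftrightarrow> ?null9"
    by (use nets(1-3) d_net uaws_seq uo_seq uaw_seq d_seq uo_d uaw_d uaws_d null9 in satx)+
  have un_eqs: "?f \<in> un_dual TYPE('i) \<longleftrightarrow> ?null9" "?seq (\<lambda>x'. un_null x' sequentially) \<longleftrightarrow> ?null9"
    if "order_continuous_norm TYPE('e dual)"
    by (use that nets(4) un_seq un_uo uo_d null9 in satx)+
  show ?thesis
  proof (intro conjI impI)
    show "all_equivalent [?f \<in> uaws_dual TYPE('i), ?seq (\<lambda>x'. uaws_null x' sequentially),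
        ?f \<in> uo_dual TYPE('i), ?seq (\<lambda>x'. uo_null x' sequentially),
        ?f \<in> uaw_dual TYPE('i), ?seq (\<lambda>x'. uaw_null x' sequentially),
        ?f \<in> d_dual TYPE('i), ?seq (disjoint_net UNIV), ?null9]"
      by (rule all_equivalentI[where q = ?null9], unfold list.pred_inject,
          intro conjI list.pred_inject(1) refl eqs)
    assume oc: "order_continuous_norm TYPE('e dual)"
    show "all_equivalent [?null9, ?f \<in> un_dual TYPE('i),
        ?seq (\<lambda>x'. un_null x' sequentially)]"
      by (rule all_equivalentI[where q = ?null9], unfold list.pred_inject,
          intro conjI list.pred_inject(1) refl un_eqs[OF oc])
  qed
qed

end
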